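(* Let $\alpha\in(1,2)$, $\sigma\in\mathbb{R}\setminus\{0\}$, let $(L^\alpha_t)_{t\in\mathbb{R}}$ be either the truncated or the non-truncated $\alpha$-stable process on $\mathbb{R}$, and let $\{a_\beta(\omega)\}_{\omega\in\Omega}$ be the unique attracting random equilibrium of $$\mathrm{d}X_t=(\beta X_t-X_t^3)\,\mathrm{d}t+\sigma\,\mathrm{d}L^\alpha_t,\qquad X_0\in\mathbb{R},$$ with associated random dynamical system $\varphi$. (i) If $\beta<0$, the random attractor $\{a_\beta(\omega)\}_{\omega\in\Omega}$ is globally uniformly exponentially attractive: for almost all $\omega\in\Omega$, $$|\varphi(t,\omega,x)-\varphi(t,\omega,a_\beta(\omega))|\le e^{\beta t}|x-a_\beta(\omega)|\qquad\text{for all }x\in\mathbb{R},\ t\ge0.$$ (ii) If $\beta>0$, the random attractor $\{a_\beta(\omega)\}_{\omega\in\Omega}$ is not locally uniformly attractive, i.e. there is no $\delta>0$ such that $$\lim_{t\to\infty}\ \sup_{x\in(-\delta,\delta)}\ \operatorname*{ess\,sup}_{\omega\in\Omega}|\varphi(t,\omega,a_\beta(\omega)+x)-a_\beta(\theta_t\omega)|=0.$$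
   Context: Noise. For $\alpha\in(0,2)$ let $\nu_\alpha(\mathrm{d}z)=c_\alpha|z|^{-1-\alpha}\,\mathrm{d}z$ on $\mathbb{R}\setminus\{0\}$, $c_\alpha=\frac{\alpha}{2^{1-\alpha}\pi^{1/2}}\frac{\Gamma((1+\alpha)/2)}{\Gamma(1-\alpha/2)}$. Let $N$ be the Poisson random measure of jumps and $\widetilde N(t,\mathrm{d}z)=N(t,\mathrm{d}z)-t\nu(\mathrm{d}z)$. The non-truncated process is the two-sided symmetric $\alpha$-stable Lévy process, with $\nu=\nu_\alpha$ and $L_t=\int_{|z|<1}z\,\widetilde N(t,\mathrm{d}z)+\int_{|z|\ge1}z\,N(t,\mathrm{d}z)$. The truncated process is the two-sided Lévy process with $\nu=\nu_\alpha|_{\{|z|<1\}}$ and $L_t=\int_{|z|<1}z\,\widetilde N(t,\mathrm{d}z)$. Random dynamical system. $(\Omega,\mathcal F,\mathbb P)$ is the canonical space of two-sided càdlàg paths with $L_t(\omega)=\omega(t)$, $\omega(0)=0$, and $\theta_t\omega(\cdot)=\omega(t+\cdot)-\omega(t)$. The equation generates a random dynamical system (cocycle) $\varphi=\varphi_\beta$ over $\theta$: $\varphi(t,\omega,x)$ is the solution at time $t\ge0$ started at $x$ at time $0$. Random equilibrium. The system has a (pullback) random attractor consisting of a single point $\{a_\beta(\omega)\}$: $a_\beta:\Omega\to\mathbb{R}$ is measurable and, $\mathbb P$-a.s., $\varphi(t,\omega,a_\beta(\omega))=a_\beta(\theta_t\omega)$ for all $t\ge0$ and $\lim_{t\to\infty}\sup_{x\in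 B}|\varphi(t,\theta_{-t}\omega,x)-a_\beta(\omega)|=0$ for every bounded $B\subset\mathbb{R}$. *)

theory Defs
  imports "HOL-Probability.Probability"
begin

section \<open>Canonical path space\<close>

definition cadlag :: "(real \<Rightarrow> real) \<Rightarrow> bool" where
  "cadlag \<omega> \<longleftrightarrow> (\<forall>t. (\<omega> \<longlongrightarrow> \<omega> t) (at_right t) \<and> (\<exists>l. (\<omega> \<longlongrightarrow> l) (at_left t)))"

definition path_set :: "(real \<Rightarrow> real) set" where
  "path_set = {\<omega>. cadlag \<omega> \<and> \<omega> 0 = 0}"

text \<open>The \<open>\<sigma>\<close>-algebra is the one generated by the coordinate maps, which is the Borel
  \<open>\<sigma>\<close>-algebra of the Skorokhod topology. Only the measurable space matters here.\<close>

definition path_space :: "(real \<Rightarrow> real) measure" where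
  "path_space = restrict_space (Pi\<^sub>M UNIV (\<lambda>_. borel)) path_set"

definition shift :: "real \<Rightarrow> (real \<Rightarrow> real) \<Rightarrow> (real \<Rightarrow> real)" where
  "shift t \<omega> = (\<lambda>s. \<omega> (t + s) - \<omega> t)"


section \<open>Stable and truncated stable noise\<close>

definition stable_const :: "real \<Rightarrow> real" where
  "stable_const \<alpha> = \<alpha> / (2 powr (1 - \<alpha>) * sqrt pi) * (Gamma ((1 + \<alpha>) / 2) / Gamma (1 - \<alpha> / 2))"

text \<open>The density vanishes at \<open>z = 0\<close> because \<open>0 powr a = 0\<close>.\<close>

definition stable_measure :: "real \<Rightarrow> real measure" where
  "stable_measure \<alpha> = density lborel (\<lambda>z. ennreal (stable_const \<alpha> * \<bar>z\<bar> powr (- 1 - \<alpha>)))"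

definition truncated_stable_measure :: "real \<Rightarrow> real measure" where
  "truncated_stable_measure \<alpha> = density (stable_measure \<alpha>) (indicator {z. \<bar>z\<bar> < 1})"

definition jump :: "(real \<Rightarrow> real) \<Rightarrow> real \<Rightarrow> real" where
  "jump \<omega> t = \<omega> t - Lim (at_left t) \<omega>"

text \<open>The random measure of jumps, as a counting measure on time \<open>\<times>\<close> jump size.\<close>

definition jump_count :: "(real \<Rightarrow> real) \<Rightarrow> (real \<times> real) set \<Rightarrow> ennreal" where
  "jump_count \<omega> B = emeasure (count_space UNIV) {t. jump \<omega> t \<noteq> 0 \<and> (t, jump \<omega> t) \<in> B}"

definition poisson_random_measure ::
  "'a measure \<Rightarrow> ('a \<Rightarrow> 'b set \<Rightarrow> ennreal) \<Rightarrow> 'b measure \<Rightarrow> bool" where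
  "poisson_random_measure P N \<mu> \<longleftrightarrow>
     (\<forall>B\<in>sets \<mu>. (\<lambda>\<omega>. N \<omega> B) \<in> borel_measurable P) \<and>
     (\<forall>B\<in>sets \<mu>. emeasure \<mu> B < \<infinity> \<longrightarrow>
        (\<forall>k::nat. measure P {\<omega> \<in> space P. N \<omega> B = of_nat k}
                   = measure \<mu> B ^ k / fact k * exp (- measure \<mu> B))) \<and>
     (\<forall>B :: nat \<Rightarrow> 'b set. range B \<subseteq> sets \<mu> \<longrightarrow> disjoint_family B \<longrightarrow>
        prob_space.indep_vars P (\<lambda>_. borel) (\<lambda>i \<omega>. N \<omega> (B i)) UNIV)"

text \<open>A law on path space under which the coordinate process, with two-sided time, is a Levy
  process whose jumps form a Poisson random measure of intensity \<open>dt \<otimes> \<nu>\<close>. The paths are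
  cadlag and vanish at \<open>0\<close> by the choice of the path space; finite families of times are covered
  by eventually constant sequences.\<close>

definition levy_law :: "(real \<Rightarrow> real) measure \<Rightarrow> real measure \<Rightarrow> bool" where
  "levy_law P \<nu> \<longleftrightarrow>
     prob_space P \<and> space P = path_set \<and> sets P = sets path_space \<and>
     (\<forall>t :: nat \<Rightarrow> real. mono t \<longrightarrow>
        prob_space.indep_vars P (\<lambda>_. borel) (\<lambda>i \<omega>. \<omega> (t (Suc i)) - \<omega> (t i)) UNIV) \<and>
     (\<forall>s t. s < t \<longrightarrow>
        distr P borel (\<lambda>\<omega>. \<omega> t - \<omega> s) = distr P borel (\<lambda>\<omega>. \<omega> (t - s))) \<and>
     poisson_random_measure P jump_count (lborel \<Otimes>\<^sub>M \<nu>)"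

text \<open>\<open>\<integral>\<^bsub>A\<^esub> z N((s,t], dz)\<close>; on cadlag paths the sum is finite whenever \<open>A\<close> is bounded away
  from \<open>0\<close>, which is the only use made of it.\<close>

definition jump_integral :: "(real \<Rightarrow> real) \<Rightarrow> real \<Rightarrow> real \<Rightarrow> real set \<Rightarrow> real" where
  "jump_integral \<omega> s t A = (\<Sum>r\<in>{r. s < r \<and> r \<le> t \<and> jump \<omega> r \<in> A}. jump \<omega> r)"

text \<open>\<open>Y\<close> is a version of the compensated integral of \<open>z\<close> over \<open>(s,t] \<times> {|z| < 1}\<close>, which is
  by definition the limit in \<open>L\<^sup>2(P)\<close> of the integrals over \<open>(s,t] \<times> {e \<le> |z| < 1}\<close> as
  \<open>e\<close> decreases to \<open>0\<close>.\<close>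

definition compensated_small_jumps ::
  "(real \<Rightarrow> real) measure \<Rightarrow> real measure \<Rightarrow> real \<Rightarrow> real \<Rightarrow> ((real \<Rightarrow> real) \<Rightarrow> real) \<Rightarrow> bool" where
  "compensated_small_jumps P \<nu> s t Y \<longleftrightarrow> Y \<in> borel_measurable P \<and>
     ((\<lambda>e. \<integral>\<^sup>+ \<omega>. ennreal ((jump_integral \<omega> s t {z. e \<le> \<bar>z\<bar> \<and> \<bar>z\<bar> < 1}
              - (t - s) * (LINT z:{z. e \<le> \<bar>z\<bar> \<and> \<bar>z\<bar> < 1}|\<nu>. z) - Y \<omega>)\<^sup>2) \<partial>P)
        \<longlongrightarrow> 0) (at_right 0)"

text \<open>The representations of \<open>L\<close> are stated for the increments over all \<open>(s,t]\<close>. Since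
  \<open>L\<^sub>0 = 0\<close>, this is the formula for \<open>L\<^sub>t\<close> with the usual convention that \<open>N(t,dz)\<close>
  stands for \<open>N((0,t],dz)\<close> if \<open>t \<ge> 0\<close> and for \<open>- N((t,0],dz)\<close> if \<open>t < 0\<close>.\<close>

definition stable_law :: "real \<Rightarrow> (real \<Rightarrow> real) measure \<Rightarrow> bool" where
  "stable_law \<alpha> P \<longleftrightarrow> levy_law P (stable_measure \<alpha>) \<and>
     (\<forall>s t. s < t \<longrightarrow> (\<exists>Y. compensated_small_jumps P (stable_measure \<alpha>) s t Y \<and>
        (AE \<omega> in P. \<omega> t - \<omega> s = Y \<omega> + jump_integral \<omega> s t {z. 1 \<le> \<bar>z\<bar>})))"

definition truncated_stable_law :: "real \<Rightarrow> (real \<Rightarrow> real) measure \<Rightarrow> bool" where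
  "truncated_stable_law \<alpha> P \<longleftrightarrow> levy_law P (truncated_stable_measure \<alpha>) \<and>
     (\<forall>s t. s < t \<longrightarrow> (\<exists>Y. compensated_small_jumps P (truncated_stable_measure \<alpha>) s t Y \<and>
        (AE \<omega> in P. \<omega> t - \<omega> s = Y \<omega>)))"


section \<open>The equation and its random equilibrium\<close>

text \<open>The noise is additive, so the equation is understood pathwise, as the integral equation
  \<open>X t = x + (\<integral>\<^sub>0\<^sup>t (\<beta> X s - (X s)\<^sup>3) ds) + \<sigma> \<omega>(t)\<close>.\<close>

definition solves_sde ::
  "real \<Rightarrow> real \<Rightarrow> (real \<Rightarrow> real) \<Rightarrow> real \<Rightarrow> (real \<Rightarrow> real) \<Rightarrow> bool" where
  "solves_sde \<beta> \<sigma> \<omega> x X \<longleftrightarrow>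
     (\<forall>t\<ge>0. ((\<lambda>s. \<beta> * X s - X s ^ 3) has_integral (X t - x - \<sigma> * \<omega> t)) {0..t})"

definition random_dynamical_system :: "(real \<Rightarrow> (real \<Rightarrow> real) \<Rightarrow> real \<Rightarrow> real) \<Rightarrow> bool" where
  "random_dynamical_system \<phi> \<longleftrightarrow>
     (\<lambda>(t, \<omega>, x). \<phi> t \<omega> x)
       \<in> borel_measurable (restrict_space borel {0..} \<Otimes>\<^sub>M path_space \<Otimes>\<^sub>M borel) \<and>
     (\<forall>\<omega>\<in>path_set. \<forall>x. \<phi> 0 \<omega> x = x \<and>
        (\<forall>s\<ge>0. \<forall>t\<ge>0. \<phi> (t + s) \<omega> x = \<phi> t (shift s \<omega>) (\<phi> s \<omega> x)))"

definition sde_rds :: "real \<Rightarrow> real \<Rightarrow> (real \<Rightarrow> (real \<Rightarrow> real) \<Rightarrow> real \<Rightarrow> real) \<Rightarrow> bool" where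
  "sde_rds \<beta> \<sigma> \<phi> \<longleftrightarrow> random_dynamical_system \<phi> \<and>
     (\<forall>\<omega>\<in>path_set. \<forall>x. solves_sde \<beta> \<sigma> \<omega> x (\<lambda>t. \<phi> t \<omega> x))"

text \<open>Suprema are taken in \<open>ennreal\<close>, where they always exist and the empty one is \<open>0\<close>.
  Uniqueness is not a separate condition: applied to \<open>B = {0}\<close>, pullback attraction determines
  \<open>a\<close> almost surely.\<close>

definition attracting_random_equilibrium ::
  "(real \<Rightarrow> real) measure \<Rightarrow> (real \<Rightarrow> (real \<Rightarrow> real) \<Rightarrow> real \<Rightarrow> real)
     \<Rightarrow> ((real \<Rightarrow> real) \<Rightarrow> real) \<Rightarrow> bool" where
  "attracting_random_equilibrium P \<phi> a \<longleftrightarrow> a \<in> borel_measurable P \<and>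
     (AE \<omega> in P. (\<forall>t\<ge>0. \<phi> t \<omega> (a \<omega>) = a (shift t \<omega>)) \<and>
        (\<forall>B. bounded B \<longrightarrow>
          ((\<lambda>t. SUP x\<in>B. ennreal \<bar>\<phi> t (shift (- t) \<omega>) x - a \<omega>\<bar>) \<longlongrightarrow> 0) at_top))"

end

theory Submission
  imports Defs
begin

text \<open>The difference of two solutions driven by the same path solves a linear equation with
  coefficient \<open>\<beta> - (X\<^sup>2 + X Y + Y\<^sup>2) \<le> \<beta>\<close>, which gives (i) for every path. The noise
  has jumps, so solutions have right derivatives only, and these suffice.

  For (ii), \<open>a\<close> is a pullback limit and hence measurable with respect to the past, so independent
  of the noise after time \<open>0\<close>. Let \<open>y\<close> be in the support of the law of \<open>a\<close>. With positive
  probability the noise moves quickly by about \<open>- y / \<sigma>\<close> and then stays close to its new value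
  up to an arbitrarily late time \<open>T\<close>. On this event the solutions from \<open>y + r\<close> and \<open>y - r\<close>
  reach opposite sides of the repelling point \<open>0\<close> and are kept apart there by a distance that does
  not depend on \<open>T\<close>; by monotonicity so are the solutions from \<open>a + 2 r\<close> and \<open>a - 2 r\<close>, which
  uniform attraction would bring together. Only independence and stationarity of the increments
  and the presence of small jumps of both signs enter, so that the stable and the truncated noise
  are treated alike.\<close>

section \<open>Right derivatives and the pathwise equation\<close>

text \<open>This replaces the mean value theorem, which would need two-sided derivatives. For each
  slope \<open>e > 0\<close>, the times up to which \<open>g\<close> stays below the line of slope
  \<open>e\<close> through its starting value form an interval. By continuity it contains its
  supremum, and a right derivative below \<open>e\<close> pushes it further to the right, so it
  reaches \<open>b\<close>; then \<open>e\<close> tends to 0.\<close>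

lemma right_derivative_nonpos_imp_le:
  fixes g g' :: "real \<Rightarrow> real"
  assumes "a \<le> b" and cont: "continuous_on {a..b} g"
    and deriv: "\<And>t. a \<le> t \<Longrightarrow> t < b \<Longrightarrow> (g has_real_derivative g' t) (at t within {t..b})"
    and nonpos: "\<And>t. a \<le> t \<Longrightarrow> t < b \<Longrightarrow> g' t \<le> 0"
  shows "g b \<le> g a"
proof (rule field_le_epsilon)
  fix e0 :: real assume "e0 > 0"
  \<comment> \<open>The total rise \<open>e * (b - a)\<close> is at most \<open>e0\<close>; the
    \<open>+ 1\<close> covers the case \<open>a = b\<close>.\<close>
  define e where "e = e0 / (b - a + 1)"
  have e: "e > 0" "e * (b - a) \<le> e0"
    using \<open>e0 > 0\<close> \<open>a \<le> b\<close> by (auto simp: e_def field_simps)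
  define S where "S = {t\<in>{a..b}. \<forall>s\<in>{a..t}. g s \<le> g a + e * (s - a)}"
  define c where "c = Sup S"
  have S: "a \<in> S" "bdd_above S"
    using \<open>a \<le> b\<close> by (auto simp: S_def intro!: bdd_aboveI[of _ b])
  have c: "a \<le> c" "c \<le> b"
    unfolding c_def using S by (auto simp: S_def intro!: cSup_upper cSup_least)
  have below: "g s \<le> g a + e * (s - a)" if "a \<le> s" "s < c" for s
  proof -
    obtain t where "t \<in> S" "s < t"
      using \<open>s < c\<close> less_cSup_iff[of S s] S unfolding c_def by auto
    then show ?thesis using that by (auto simp: S_def)
  qed
  have "g c \<le> g a + e * (c - a)"
  proof (cases "c = a")
    case False
    then have "a < c" using c by simp
    have "(g \<longlongrightarrow> g c) (at c within {a..b})"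
      using cont c by (simp add: continuous_on_def)
    then have "(g \<longlongrightarrow> g c) (at c within {a..c})"
      by (rule tendsto_within_subset) (use c in auto)
    then have "(g \<longlongrightarrow> g c) (at_left c)"
      using \<open>a < c\<close> by (simp add: at_within_Icc_at_left)
    then have "((\<lambda>s. g a + e * (s - a) - g s) \<longlongrightarrow> g a + e * (c - a) - g c) (at_left c)"
      by (intro tendsto_intros)
    moreover have "\<forall>\<^sub>F s in at_left c. 0 \<le> g a + e * (s - a) - g s"
      unfolding eventually_at_left[OF \<open>a < c\<close>] using below \<open>a < c\<close> by (intro exI[of _ a]) auto
    ultimately have "0 \<le> g a + e * (c - a) - g c"
      by (intro tendsto_lowerbound[of _ _ "at_left c"]) auto
    then show ?thesis by simp
  qed simp
  with below have upto: "g s \<le> g a + e * (s - a)" if "a \<le> s" "s \<le> c" for s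
    using that by (cases "s = c") auto
  have "c = b"
  proof (rule ccontr)
    assume "c \<noteq> b"
    with c have "c < b" by simp
    have "((\<lambda>y. (g y - g c) / (y - c)) \<longlongrightarrow> g' c) (at c within {c..b})"
      using deriv[of c] c \<open>c < b\<close> by (simp add: has_field_derivative_iff)
    moreover have "g' c < e" using nonpos[of c] c \<open>c < b\<close> e by simp
    ultimately have "\<forall>\<^sub>F y in at c within {c..b}. (g y - g c) / (y - c) < e"
      by (rule order_tendstoD(2))
    then obtain d where d: "d > 0"
      "\<And>y. y \<in> {c..b} \<Longrightarrow> y \<noteq> c \<Longrightarrow> dist y c < d \<Longrightarrow> (g y - g c) / (y - c) < e"
      by (auto simp: eventually_at)
    define t where "t = min b (c + d / 2)"
    have t: "c < t" "t \<le> b" using d \<open>c < b\<close> by (auto simp: t_def)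
    have "g s \<le> g a + e * (s - a)" if s: "a \<le> s" "s \<le> t" for s
    proof (cases "s \<le> c")
      case False
      have "(g s - g c) / (s - c) < e"
        using False s t d(1) by (intro d(2)) (auto simp: t_def dist_real_def)
      then have "g s \<le> g c + e * (s - c)"
        using False by (simp add: field_simps)
      with upto[of c] c show ?thesis by (simp add: algebra_simps)
    qed (use upto s in auto)
    then have "t \<in> S" using t c by (auto simp: S_def)
    then have "t \<le> c" using S unfolding c_def by (intro cSup_upper)
    with t show False by simp
  qed
  with upto[of b] c e show "g b \<le> g a + e0" by simp
qed

text \<open>After the last time \<open>t0\<close> with \<open>g \<ge> 0\<close>, where
  \<open>g\<close> vanishes, the function would have to sink through the layer between
  \<open>- \<kappa>\<close> and 0, in which its right derivative is nonnegative. Asking for the sign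
  only in this layer is essential: the drift is controlled near the barrier, not far below
  it.\<close>

lemma right_derivative_barrier:
  fixes g g' :: "real \<Rightarrow> real"
  assumes "a \<le> b" and cont: "continuous_on {a..b} g"
    and deriv: "\<And>t. a \<le> t \<Longrightarrow> t < b \<Longrightarrow> (g has_real_derivative g' t) (at t within {t..b})"
    and "g a \<ge> 0" and "\<kappa> > 0"
    and barrier: "\<And>t. a \<le> t \<Longrightarrow> t < b \<Longrightarrow> - \<kappa> < g t \<Longrightarrow> g t \<le> 0 \<Longrightarrow> g' t \<ge> 0"
  shows "g b \<ge> 0"
proof (rule ccontr)
  assume "\<not> g b \<ge> 0"
  then have gb: "g b < 0" by simp
  have "closed ({a..b} \<inter> g -` {0..})"
    using cont by (intro continuous_closed_preimage) auto
  then have "compact ({a..b} \<inter> g -` {0..})"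
    by (auto simp: compact_eq_bounded_closed intro: bounded_subset[of "{a..b}"])
  moreover have "{a..b} \<inter> g -` {0..} \<noteq> {}" using assms by auto
  ultimately obtain t0 where t0: "a \<le> t0" "t0 \<le> b" "g t0 \<ge> 0"
    and max: "\<And>t. a \<le> t \<Longrightarrow> t \<le> b \<Longrightarrow> g t \<ge> 0 \<Longrightarrow> t \<le> t0"
    using compact_attains_sup[of "{a..b} \<inter> g -` {0..}"] by (metis Int_iff atLeastAtMost_iff atLeast_iff vimage_eq)
  have "\<exists>x\<ge>t0. x \<le> b \<and> g x = 0"
    using t0 gb cont by (intro IVT2') (auto intro: continuous_on_subset)
  then obtain x where x: "t0 \<le> x" "x \<le> b" "g x = 0" by blast
  then have "x \<le> t0" using max[of x] t0 by simp
  with x have g0: "g t0 = 0" by simp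
  with gb t0 have "t0 < b" by (cases "t0 = b") auto
  have "(g \<longlongrightarrow> 0) (at t0 within {a..b})"
    using cont t0 g0 by (force simp: continuous_on_def)
  then have "\<forall>\<^sub>F s in at t0 within {a..b}. - \<kappa> < g s"
    using \<open>\<kappa> > 0\<close> by (intro order_tendstoD(1)) auto
  then obtain d where d: "d > 0"
    "\<And>s. s \<in> {a..b} \<Longrightarrow> s \<noteq> t0 \<Longrightarrow> dist s t0 < d \<Longrightarrow> - \<kappa> < g s"
    by (auto simp: eventually_at)
  define t1 where "t1 = min b (t0 + d / 2)"
  have t1: "t0 < t1" "t1 \<le> b" using \<open>t0 < b\<close> d by (auto simp: t1_def)
  have neg: "g t < 0" if "t0 < t" "t \<le> t1" for t
    using max[of t] that t0 t1 by force
  have "- g t1 \<le> - g t0"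
  proof (rule right_derivative_nonpos_imp_le[where g = "\<lambda>t. - g t" and g' = "\<lambda>t. - g' t"])
    show "continuous_on {t0..t1} (\<lambda>t. - g t)"
      using cont t0 t1 by (auto intro!: continuous_intros intro: continuous_on_subset)
    fix t assume t: "t0 \<le> t" "t < t1"
    show "((\<lambda>t. - g t) has_real_derivative - g' t) (at t within {t..t1})"
      using deriv[of t] t t0 t1 by (intro derivative_intros) (auto intro: DERIV_subset)
    have "- \<kappa> < g t"
      using t t0 t1 d \<open>\<kappa> > 0\<close> g0 by (cases "t = t0") (auto simp: t1_def dist_real_def)
    moreover have "g t \<le> 0" using neg[of t] t g0 by (cases "t = t0") auto
    ultimately show "- g' t \<le> 0" using barrier[of t] t t0 t1 by simp
  qed (use t1 in auto)
  with neg[of t1] t1 g0 show False by simp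
qed

section \<open>Solutions of the integral equation up to a finite time\<close>

text \<open>With a finite horizon, paths that agree on \<open>{0..T}\<close> have the same
  solutions. This is what allows a path to be compared with its stopped version.\<close>

definition solves_upto ::
  "real \<Rightarrow> real \<Rightarrow> (real \<Rightarrow> real) \<Rightarrow> real \<Rightarrow> real \<Rightarrow> (real \<Rightarrow> real) \<Rightarrow> bool" where
  "solves_upto \<beta> \<sigma> \<omega> x T X \<longleftrightarrow>
     (\<forall>t\<in>{0..T}. ((\<lambda>s. \<beta> * X s - X s ^ 3) has_integral (X t - x - \<sigma> * \<omega> t)) {0..t})"

lemma solves_sde_imp_upto: "solves_sde \<beta> \<sigma> \<omega> x X \<Longrightarrow> solves_upto \<beta> \<sigma> \<omega> x T X"
  by (auto simp: solves_sde_def solves_upto_def)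

text \<open>The drift is odd, so reflection only changes the sign of \<open>\<sigma>\<close>. Every
  lower bound on solutions thus yields an upper bound.\<close>

lemma solves_upto_uminus:
  assumes "solves_upto \<beta> \<sigma> \<omega> x T X"
  shows "solves_upto \<beta> (- \<sigma>) \<omega> (- x) T (\<lambda>t. - X t)"
  unfolding solves_upto_def
proof
  fix t assume "t \<in> {0..T}"
  then have "((\<lambda>s. - (\<beta> * X s - X s ^ 3)) has_integral - (X t - x - \<sigma> * \<omega> t)) {0..t}"
    using assms by (intro has_integral_neg) (auto simp: solves_upto_def)
  then show "((\<lambda>s. \<beta> * - X s - (- X s) ^ 3) has_integral - X t - - x - - \<sigma> * \<omega> t) {0..t}"
    by (simp add: algebra_simps)
qed

lemma solves_upto_integral:
  assumes "solves_upto \<beta> \<sigma> \<omega> x T X" "t \<in> {0..T}"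
  shows "integral {0..t} (\<lambda>s. \<beta> * X s - X s ^ 3) = X t - x - \<sigma> * \<omega> t"
  using assms by (simp add: solves_upto_def integral_unique)

lemma solves_upto_start:
  assumes "solves_upto \<beta> \<sigma> \<omega> x T X" "0 \<le> T"
  shows "X 0 - \<sigma> * \<omega> 0 = x"
  using solves_upto_integral[OF assms(1), of 0] assms(2) by simp

lemma solves_upto_continuous_on:
  assumes "solves_upto \<beta> \<sigma> \<omega> x T X"
  shows "continuous_on {0..T} (\<lambda>t. X t - \<sigma> * \<omega> t)"
proof (cases "0 \<le> T")
  case True
  let ?h = "\<lambda>s. \<beta> * X s - X s ^ 3"
  have "continuous_on {0..T} (\<lambda>t. x + integral {0..t} ?h)"
    using assms True by (intro continuous_intros indefinite_integral_continuous_1)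
      (auto simp: solves_upto_def integrable_on_def)
  moreover have "x + integral {0..t} ?h = X t - \<sigma> * \<omega> t" if "t \<in> {0..T}" for t
    using solves_upto_integral[OF assms that] by simp
  ultimately show ?thesis by (rule continuous_on_eq)
qed simp

text \<open>The part \<open>X t - \<sigma> * \<omega> t\<close> is an indefinite integral, hence
  continuous. Together with right continuity of \<open>\<omega>\<close> this makes \<open>X\<close>,
  and so the integrand, right continuous, and the fundamental theorem of calculus holds from the
  right.\<close>

lemma solves_upto_right_derivative:
  assumes sol: "solves_upto \<beta> \<sigma> \<omega> x T X" and right: "\<And>t. (\<omega> \<longlongrightarrow> \<omega> t) (at_right t)"
    and t: "0 \<le> t" "t < T"
  shows "((\<lambda>t. X t - \<sigma> * \<omega> t) has_real_derivative (\<beta> * X t - X t ^ 3)) (at t within {t..T})"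
proof -
  let ?h = "\<lambda>s. \<beta> * X s - X s ^ 3" and ?Z = "\<lambda>t. X t - \<sigma> * \<omega> t"
  have "(?Z \<longlongrightarrow> ?Z t) (at t within {0..T})"
    using solves_upto_continuous_on[OF sol] t by (simp add: continuous_on_def)
  then have "(?Z \<longlongrightarrow> ?Z t) (at t within {t..T})"
    by (rule tendsto_within_subset) (use t in auto)
  moreover have "(\<omega> \<longlongrightarrow> \<omega> t) (at t within {t..T})"
    using right[of t] t by (simp add: at_within_Icc_at_right)
  ultimately have "((\<lambda>u. ?Z u + \<sigma> * \<omega> u) \<longlongrightarrow> ?Z t + \<sigma> * \<omega> t) (at t within {t..T})"
    by (intro tendsto_add tendsto_mult_left)
  then have X: "(X \<longlongrightarrow> X t) (at t within {t..T})" by simp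
  have int: "?h integrable_on {0..u}" if "u \<in> {0..T}" for u
    using sol that by (auto simp: solves_upto_def integrable_on_def)
  have "continuous (at t within {t..T}) ?h"
    unfolding continuous_within by (intro tendsto_intros X)
  moreover have "?h integrable_on {t..T}"
    using int[of T] t by (auto intro: integrable_on_subinterval)
  ultimately have "((\<lambda>u. integral {t..u} ?h) has_vector_derivative ?h t) (at t within {t..T})"
    using integral_has_vector_derivative_continuous_at[of ?h t T t "{}"] t by simp
  then have "((\<lambda>u. ?Z t + integral {t..u} ?h) has_real_derivative ?h t) (at t within {t..T})"
    by (auto simp: has_real_derivative_iff_has_vector_derivative intro!: derivative_eq_intros)
  then show ?thesis
  proof (rule has_field_derivative_transform_within[OF _ zero_less_one])
    show "t \<in> {t..T}" using t by simp
    fix u assume that: "u \<in> {t..T}"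
    have "integral {0..t} ?h + integral {t..u} ?h = integral {0..u} ?h"
      using that t by (intro Henstock_Kurzweil_Integration.integral_combine int) auto
    moreover have "integral {0..v} ?h = ?Z v - x" if "v \<in> {0..T}" for v
      using solves_upto_integral[OF sol that] by simp
    ultimately show "?Z t + integral {t..u} ?h = ?Z u" using that t by simp
  qed
qed

text \<open>The noise cancels in the difference \<open>d\<close>, and the weight
  \<open>exp (- 2 * \<beta> * t)\<close> removes the linear growth of \<open>d\<close> squared,
  leaving a derivative with the sign of \<open>- q t\<close>. For \<open>x = y\<close> this is
  uniqueness of solutions.\<close>

lemma solves_upto_contraction:
  assumes X: "solves_upto \<beta> \<sigma> \<omega> x T X" and Y: "solves_upto \<beta> \<sigma> \<omega> y T Y"
    and right: "\<And>t. (\<omega> \<longlongrightarrow> \<omega> t) (at_right t)" and "0 \<le> T"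
  shows "\<bar>X T - Y T\<bar> \<le> exp (\<beta> * T) * \<bar>x - y\<bar>"
proof -
  define d where "d t = (X t - \<sigma> * \<omega> t) - (Y t - \<sigma> * \<omega> t)" for t
  have d: "continuous_on {0..T} d"
    unfolding d_def[abs_def]
    by (rule continuous_on_diff[OF solves_upto_continuous_on[OF X] solves_upto_continuous_on[OF Y]])
  define q where "q t = X t ^ 2 + X t * Y t + Y t ^ 2" for t
  have q: "q t \<ge> 0" for t
  proof -
    have "4 * q t = (X t - Y t)\<^sup>2 + 3 * (X t + Y t)\<^sup>2"
      by (simp add: q_def power2_eq_square algebra_simps)
    then show ?thesis by (smt (verit) zero_le_power2)
  qed
  have "exp (- 2 * \<beta> * T) * (d T)\<^sup>2 \<le> exp (- 2 * \<beta> * 0) * (d 0)\<^sup>2"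
  proof (rule right_derivative_nonpos_imp_le[OF \<open>0 \<le> T\<close>,
        where g = "\<lambda>t. exp (- 2 * \<beta> * t) * (d t)\<^sup>2" and
        g' = "\<lambda>t. - 2 * exp (- 2 * \<beta> * t) * (d t)\<^sup>2 * q t"])
    show "continuous_on {0..T} (\<lambda>t. exp (- 2 * \<beta> * t) * (d t)\<^sup>2)"
      by (intro continuous_intros d)
    fix t assume t: "0 \<le> t" "t < T"
    have "(d has_real_derivative ((\<beta> * X t - X t ^ 3) - (\<beta> * Y t - Y t ^ 3))) (at t within {t..T})"
      unfolding d_def using t
      by (intro DERIV_diff solves_upto_right_derivative[OF X right] solves_upto_right_derivative[OF Y right])
    moreover have "(\<beta> * X t - X t ^ 3) - (\<beta> * Y t - Y t ^ 3) = d t * (\<beta> - q t)"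
      by (simp add: d_def q_def power2_eq_square power3_eq_cube algebra_simps)
    ultimately have "(d has_real_derivative (d t * (\<beta> - q t))) (at t within {t..T})" by simp
    then show "((\<lambda>t. exp (- 2 * \<beta> * t) * (d t)\<^sup>2) has_real_derivative
        - 2 * exp (- 2 * \<beta> * t) * (d t)\<^sup>2 * q t) (at t within {t..T})"
      by (auto intro!: derivative_eq_intros simp: power2_eq_square algebra_simps)
    show "- 2 * exp (- 2 * \<beta> * t) * (d t)\<^sup>2 * q t \<le> 0" using q[of t] by simp
  qed
  moreover have "d 0 = x - y"
    using solves_upto_start[OF X] solves_upto_start[OF Y] \<open>0 \<le> T\<close> by (simp add: d_def)
  moreover have "d T = X T - Y T" by (simp add: d_def)
  ultimately have "exp (- 2 * \<beta> * T) * (X T - Y T)\<^sup>2 \<le> (x - y)\<^sup>2" by simp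
  then have "exp (2 * \<beta> * T) * (exp (- 2 * \<beta> * T) * (X T - Y T)\<^sup>2) \<le> exp (2 * \<beta> * T) * (x - y)\<^sup>2"
    by (intro mult_left_mono) auto
  moreover have "exp (2 * \<beta> * T) * (exp (- 2 * \<beta> * T) * (X T - Y T)\<^sup>2) = (X T - Y T)\<^sup>2"
    by (simp flip: mult.assoc exp_add)
  moreover have "exp (2 * \<beta> * T) = (exp (\<beta> * T))\<^sup>2"
    by (simp add: mult.assoc flip: exp_double)
  ultimately have "(X T - Y T)\<^sup>2 \<le> (exp (\<beta> * T) * (x - y))\<^sup>2"
    by (simp only: power_mult_distrib)
  then have "\<bar>X T - Y T\<bar> \<le> \<bar>exp (\<beta> * T) * (x - y)\<bar>"
    by (simp only: abs_le_square_iff)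
  then show ?thesis by (simp add: abs_mult)
qed

text \<open>The barrier is put under the continuous part of the solution, since \<open>X\<close>
  itself may jump across any level. It sinks at speed \<open>K\<close>, and the drift has to exceed
  \<open>- K\<close> only in a layer of width \<open>\<kappa>\<close> below it. Both a short-time
  estimate and, with \<open>K = 0\<close>, a trapping estimate follow.\<close>

lemma solves_upto_lower_bound:
  assumes X: "solves_upto \<beta> \<sigma> \<omega> x T X"
    and right: "\<And>t. (\<omega> \<longlongrightarrow> \<omega> t) (at_right t)" and "0 \<le> T"
    and "x \<ge> l" and "\<kappa> > 0"
    and drift: "\<And>t z. 0 \<le> t \<Longrightarrow> t < T \<Longrightarrow> l - K * t - \<kappa> < z \<Longrightarrow> z \<le> l - K * t
       \<Longrightarrow> - K \<le> \<beta> * (z + \<sigma> * \<omega> t) - (z + \<sigma> * \<omega> t) ^ 3"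
  shows "X T - \<sigma> * \<omega> T \<ge> l - K * T"
proof -
  let ?Z = "\<lambda>t. X t - \<sigma> * \<omega> t"
  have "?Z T - (l - K * T) \<ge> 0"
  proof (rule right_derivative_barrier[OF \<open>0 \<le> T\<close>, where \<kappa> = \<kappa> and
        g = "\<lambda>t. ?Z t - (l - K * t)" and
        g' = "\<lambda>t. \<beta> * X t - X t ^ 3 + K"])
    show "continuous_on {0..T} (\<lambda>t. ?Z t - (l - K * t))"
      by (intro continuous_on_diff[OF solves_upto_continuous_on[OF X]] continuous_intros)
    show "?Z 0 - (l - K * 0) \<ge> 0"
      using solves_upto_start[OF X \<open>0 \<le> T\<close>] \<open>x \<ge> l\<close> by simp
    fix t assume t: "0 \<le> t" "t < T"
    have "((\<lambda>t. l - K * t) has_real_derivative - K) (at t within {t..T})"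
      by (auto intro!: derivative_eq_intros)
    from DERIV_diff[OF solves_upto_right_derivative[OF X right t] this]
    show "((\<lambda>t. ?Z t - (l - K * t)) has_real_derivative \<beta> * X t - X t ^ 3 + K) (at t within {t..T})"
      by simp
    assume "- \<kappa> < ?Z t - (l - K * t)" "?Z t - (l - K * t) \<le> 0"
    then have "- K \<le> \<beta> * (?Z t + \<sigma> * \<omega> t) - (?Z t + \<sigma> * \<omega> t) ^ 3"
      by (intro drift t) simp_all
    then show "\<beta> * X t - X t ^ 3 + K \<ge> 0" by simp
  qed (fact \<open>\<kappa> > 0\<close>)
  then show ?thesis by simp
qed

section \<open>Independence and stationarity of the increments\<close>

lemma space_path_space [simp]: "space path_space = path_set"
  by (simp add: path_space_def space_restrict_space space_PiM)

lemma measurable_path_space_eval [measurable]: "(\<lambda>\<omega>. \<omega> t) \<in> borel_measurable path_space"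
  unfolding path_space_def by (intro measurable_restrict_space1) simp

lemma measurable_path_spaceI:
  assumes "\<And>x. x \<in> space N \<Longrightarrow> f x \<in> path_set"
    and "\<And>t. (\<lambda>x. f x t) \<in> borel_measurable N"
  shows "f \<in> measurable N path_space"
  unfolding path_space_def
proof (rule measurable_restrict_space2)
  show "f \<in> measurable N (Pi\<^sub>M UNIV (\<lambda>_. borel))"
    using measurable_PiM_single'[of UNIV "\<lambda>t x. f x t" N "\<lambda>_. borel"] assms(2) by simp
qed (use assms(1) in auto)

lemma cadlag_shift:
  assumes "cadlag \<omega>"
  shows "cadlag (shift s \<omega>)"
  unfolding cadlag_def
proof (intro allI conjI)
  fix t
  have R: "filterlim (\<lambda>u. s + u) (at_right (s + t)) (at_right t)"
    using filtermap_at_right_shift[of "- s" t] by (simp add: filterlim_def add.commute)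
  have L: "filterlim (\<lambda>u. s + u) (at_left (s + t)) (at_left t)"
    using filtermap_at_left_shift[of "- s" t] by (simp add: filterlim_def add.commute)
  have "(\<omega> \<longlongrightarrow> \<omega> (s + t)) (at_right (s + t))" using assms by (simp add: cadlag_def)
  from filterlim_compose[OF this R]
  show "(shift s \<omega> \<longlongrightarrow> shift s \<omega> t) (at_right t)"
    unfolding shift_def by (intro tendsto_intros)
  obtain l where "(\<omega> \<longlongrightarrow> l) (at_left (s + t))" using assms by (auto simp: cadlag_def)
  from filterlim_compose[OF this L]
  have "(shift s \<omega> \<longlongrightarrow> l - \<omega> s) (at_left t)"
    unfolding shift_def by (intro tendsto_intros)
  then show "\<exists>l. (shift s \<omega> \<longlongrightarrow> l) (at_left t)" ..
qed

lemma shift_path_set [simp]: "\<omega> \<in> path_set \<Longrightarrow> shift s \<omega> \<in> path_set"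
  by (auto simp: path_set_def cadlag_shift) (simp add: shift_def)

lemma path_set_zero [simp]: "\<omega> \<in> path_set \<Longrightarrow> \<omega> 0 = 0"
  by (simp add: path_set_def)

lemma path_set_right: "\<omega> \<in> path_set \<Longrightarrow> (\<omega> \<longlongrightarrow> \<omega> t) (at_right t)"
  unfolding path_set_def cadlag_def by blast

lemma path_set_left: "\<omega> \<in> path_set \<Longrightarrow> \<exists>l. (\<omega> \<longlongrightarrow> l) (at_left t)"
  unfolding path_set_def cadlag_def by blast

section \<open>Increments along finite grids of times\<close>

text \<open>Independence in \<open>levy_law\<close> is stated along monotone sequences. A finite set
  is listed in increasing order and continued by its maximum, which adds zero increments
  only.\<close>

lemma finite_subset_mono_range:
  fixes F :: "real set"
  assumes "finite F" "F \<noteq> {}"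
  obtains t :: "nat \<Rightarrow> real" where "mono t" "F \<subseteq> range t"
proof
  define xs where "xs = sorted_list_of_set F"
  have xs: "sorted xs" "set xs = F" "xs \<noteq> []" using assms by (auto simp: xs_def)
  show "mono (\<lambda>i. xs ! min i (length xs - 1))"
  proof (intro monoI sorted_nth_mono)
    show "min j (length xs - 1) < length xs" for j
      using xs(3) by (cases xs) auto
  qed (use xs in auto)
  show "F \<subseteq> range (\<lambda>i. xs ! min i (length xs - 1))"
  proof
    fix x assume "x \<in> F"
    then obtain i where "i < length xs" "xs ! i = x" using xs by (metis in_set_conv_nth)
    then show "x \<in> range (\<lambda>i. xs ! min i (length xs - 1))" by (intro image_eqI[of _ _ i]) auto
  qed
qed

text \<open>A signed telescoping sum, which recovers the displacement from index \<open>m\<close> to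
  index \<open>j\<close> out of consecutive differences. For \<open>j \<le> m\<close> it reads only
  indices below \<open>m\<close>, otherwise only indices from \<open>m\<close> on; so past and
  future use disjoint sets of indices.\<close>

definition increment :: "nat \<Rightarrow> nat \<Rightarrow> (nat \<Rightarrow> real) \<Rightarrow> real" where
  "increment m j d = (if m \<le> j then \<Sum>i=m..<j. d i else - (\<Sum>i=j..<m. d i))"

lemma increment_diff:
  "increment m j (\<lambda>i. f (Suc i) - f i) = f j - f m"
  by (auto simp: increment_def sum_Suc_diff')

lemma increment_measurable [measurable]:
  assumes "{m..<j} \<union> {j..<m} \<subseteq> I"
  shows "increment m j \<in> borel_measurable (Pi\<^sub>M I (\<lambda>_. borel))"
  unfolding increment_def[abs_def] using assms
  by (intro measurable_If borel_measurable_sum borel_measurable_uminus measurable_component_singleton) auto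

lemma increment_restrict:
  assumes "{m..<j} \<union> {j..<m} \<subseteq> I"
  shows "increment m j (restrict d I) = increment m j d"
  unfolding increment_def using assms
  by (auto intro!: sum.cong)

lemma sets_increment_cylinder:
  assumes "finite F" and X: "\<And>u. X u \<in> sets borel"
    and I: "\<And>u. u \<in> F \<Longrightarrow> {m..<j u} \<union> {j u..<m} \<subseteq> I"
  shows "{d\<in>space (Pi\<^sub>M I (\<lambda>_. borel)). \<forall>u\<in>F. increment m (j u) d \<in> X u} \<in> sets (Pi\<^sub>M I (\<lambda>_. borel))"
proof (rule sets.sets_Collect_finite_All[OF _ \<open>finite F\<close>])
  fix u assume "u \<in> F"
  from measurable_sets[OF increment_measurable[OF I[OF this]] X[of u]]
  show "{d\<in>space (Pi\<^sub>M I (\<lambda>_. borel)). increment m (j u) d \<in> X u} \<in> sets (Pi\<^sub>M I (\<lambda>_. borel))"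
    by (simp add: vimage_def Int_def conj_commute)
qed

section \<open>The algebras generated by increments from a reference time\<close>

text \<open>Paths are pinned at time 0, so coordinates before and after another time
  \<open>s\<close> would not be independent. Measuring everything from \<open>s\<close> repairs
  this.\<close>

definition cylinders :: "real \<Rightarrow> real set \<Rightarrow> (real \<Rightarrow> real) set set" where
  "cylinders s U = {{\<omega>\<in>path_set. \<forall>u\<in>F. \<omega> u - \<omega> s \<in> X u} | F X.
     finite F \<and> F \<subseteq> U \<and> (\<forall>u. X u \<in> sets (borel :: real measure))}"

lemma cylinders_subset_Pow: "cylinders s U \<subseteq> Pow path_set"
  by (auto simp: cylinders_def)

lemma Int_stable_cylinders: "Int_stable (cylinders s U)"
proof (rule Int_stableI)
  fix a b assume "a \<in> cylinders s U" "b \<in> cylinders s U"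
  then obtain F X G Y where F: "finite F" "F \<subseteq> U" "\<And>u. X u \<in> sets borel"
    and a: "a = {\<omega>\<in>path_set. \<forall>u\<in>F. \<omega> u - \<omega> s \<in> X u}"
    and G: "finite G" "G \<subseteq> U" "\<And>u. Y u \<in> sets borel"
    and b: "b = {\<omega>\<in>path_set. \<forall>u\<in>G. \<omega> u - \<omega> s \<in> Y u}"
    unfolding cylinders_def by blast
  define Z where "Z u = (if u \<in> F then X u else UNIV) \<inter> (if u \<in> G then Y u else UNIV)" for u
  have "a \<inter> b = {\<omega>\<in>path_set. \<forall>u\<in>F \<union> G. \<omega> u - \<omega> s \<in> Z u}"
    unfolding a b Z_def by auto
  moreover have "Z u \<in> sets borel" for u using F G by (auto simp: Z_def)
  ultimately show "a \<inter> b \<in> cylinders s U"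
    unfolding cylinders_def using F G
    by (intro CollectI exI[of _ "F \<union> G"] exI[of _ Z]) simp
qed

definition increment_algebra :: "real \<Rightarrow> real set \<Rightarrow> (real \<Rightarrow> real) measure" where
  "increment_algebra s U = sigma path_set (cylinders s U)"

lemma space_increment_algebra [simp]: "space (increment_algebra s U) = path_set"
  by (simp add: increment_algebra_def cylinders_subset_Pow space_measure_of_conv)

lemma sets_increment_algebra: "sets (increment_algebra s U) = sigma_sets path_set (cylinders s U)"
  by (simp add: increment_algebra_def cylinders_subset_Pow)

lemma measurable_increment:
  assumes "u \<in> U"
  shows "(\<lambda>\<omega>. \<omega> u - \<omega> s) \<in> borel_measurable (increment_algebra s U)"
proof (rule measurableI)
  fix A :: "real set" assume "A \<in> sets borel"
  have "(\<lambda>\<omega>. \<omega> u - \<omega> s) -` A \<inter> space (increment_algebra s U)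
      = {\<omega>\<in>path_set. \<forall>v\<in>{u}. \<omega> v - \<omega> s \<in> A}" by auto
  also have "\<dots> \<in> cylinders s U"
    unfolding cylinders_def using assms \<open>A \<in> sets borel\<close> by (intro CollectI exI[of _ "{u}"] exI[of _ "\<lambda>_. A"]) auto
  finally show "(\<lambda>\<omega>. \<omega> u - \<omega> s) -` A \<inter> space (increment_algebra s U) \<in> sets (increment_algebra s U)"
    unfolding sets_increment_algebra by (rule sigma_sets.Basic)
qed simp

text \<open>Paths vanish at 0, so increments from 0 are the coordinates themselves.\<close>

lemma sets_increment_algebra_UNIV: "sets (increment_algebra 0 UNIV) = sets path_space"
proof
  have "(\<lambda>\<omega>. \<omega>) \<in> measurable (increment_algebra 0 UNIV) path_space"
  proof (rule measurable_path_spaceI)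
    fix t have "(\<lambda>\<omega>. \<omega> t - \<omega> 0) \<in> borel_measurable (increment_algebra 0 UNIV)"
      by (rule measurable_increment) simp
    then show "(\<lambda>\<omega>. \<omega> t) \<in> borel_measurable (increment_algebra 0 UNIV)"
      by (rule measurable_cong[THEN iffD1, rotated]) simp
  qed simp
  note id = this
  show "sets path_space \<subseteq> sets (increment_algebra 0 UNIV)"
  proof
    fix A assume A: "A \<in> sets path_space"
    have "A \<inter> path_set = A" using sets.sets_into_space[OF A] by auto
    then show "A \<in> sets (increment_algebra 0 UNIV)"
      using measurable_sets[OF id A] by simp
  qed
  have "cylinders 0 UNIV \<subseteq> sets path_space"
  proof
    fix a assume "a \<in> cylinders 0 UNIV"
    then obtain F X where F: "finite F" "\<And>u. X u \<in> sets borel"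
      and a: "a = {\<omega>\<in>path_set. \<forall>u\<in>F. \<omega> u - \<omega> 0 \<in> X u}" unfolding cylinders_def by blast
    note [measurable] = F(2)
    have "{\<omega>\<in>space path_space. \<forall>u\<in>F. \<omega> u - \<omega> 0 \<in> X u} \<in> sets path_space"
      using F(1) by measurable
    then show "a \<in> sets path_space" by (simp add: a)
  qed
  then show "sets (increment_algebra 0 UNIV) \<subseteq> sets path_space"
    unfolding sets_increment_algebra
    using sets.sigma_sets_subset[of "cylinders 0 UNIV" path_space] by simp
qed

section \<open>Independence of past and future, and invariance under the shift\<close>

locale levy =
  fixes P :: "(real \<Rightarrow> real) measure" and \<nu> :: "real measure"
  assumes law: "levy_law P \<nu>"
begin

sublocale prob_space P
  using law by (simp add: levy_law_def)

lemma space_P [simp]: "space P = path_set"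
  using law by (simp add: levy_law_def)

lemma sets_P: "sets P = sets path_space"
  using law by (simp add: levy_law_def)

lemma measurable_eval [measurable]: "(\<lambda>\<omega>. \<omega> t) \<in> borel_measurable P"
  using measurable_path_space_eval by (simp only: measurable_cong_sets[OF sets_P refl])

lemma indep_increments:
  "mono t \<Longrightarrow> indep_vars (\<lambda>_. borel) (\<lambda>i \<omega>. \<omega> (t (Suc i)) - \<omega> (t i)) UNIV" for t :: "nat \<Rightarrow> real"
  using law by (simp add: levy_law_def)

lemma distr_increment:
  assumes "s \<le> t"
  shows "distr P borel (\<lambda>\<omega>. \<omega> (r + t) - \<omega> (r + s)) = distr P borel (\<lambda>\<omega>. \<omega> t - \<omega> s)"
proof (cases "s = t")
  case False
  have *: "\<forall>s t. s < t \<longrightarrow> distr P borel (\<lambda>\<omega>. \<omega> t - \<omega> s) = distr P borel (\<lambda>\<omega>. \<omega> (t - s))"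
    using law by (simp add: levy_law_def)
  show ?thesis
    using *[rule_format, of s t] *[rule_format, of "r + s" "r + t"] False assms by simp
qed simp

lemma sets_increment_algebra_subset: "sets (increment_algebra s U) \<subseteq> sets P"
proof -
  have "cylinders s U \<subseteq> sets P"
  proof
    fix a assume "a \<in> cylinders s U"
    then obtain F X where F: "finite F" "\<And>u. X u \<in> sets borel"
      and a: "a = {\<omega>\<in>path_set. \<forall>u\<in>F. \<omega> u - \<omega> s \<in> X u}" unfolding cylinders_def by blast
    note [measurable] = F(2)
    have "{\<omega>\<in>space P. \<forall>u\<in>F. \<omega> u - \<omega> s \<in> X u} \<in> sets P"
      using F(1) by measurable
    then show "a \<in> sets P" by (simp add: a)
  qed
  then show ?thesis
    unfolding sets_increment_algebra using sets.sigma_sets_subset[of "cylinders s U" P] by simp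
qed

text \<open>Cylinders are stable under intersection, so two of them suffice. All their times and
  \<open>s\<close> are put on one monotone grid with \<open>s\<close> at index \<open>m\<close>; the
  past event is a function of the increments below \<open>m\<close>, the future event of those from
  \<open>m\<close> on, and blocks of independent variables are independent.\<close>

lemma indep_past_future:
  "indep_set (sets (increment_algebra s {..s})) (sets (increment_algebra s {s..}))"
proof -
  have "indep_set (cylinders s {..s}) (cylinders s {s..})"
    unfolding indep_sets2_eq
  proof (intro conjI ballI)
    show "cylinders s {..s} \<subseteq> events" "cylinders s {s..} \<subseteq> events"
      using sets_increment_algebra_subset by (auto simp: sets_increment_algebra)
    fix a b assume "a \<in> cylinders s {..s}" "b \<in> cylinders s {s..}"
    then obtain F X G Y where F: "finite F" "F \<subseteq> {..s}" "\<And>u. X u \<in> sets borel"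
      and a: "a = {\<omega>\<in>path_set. \<forall>u\<in>F. \<omega> u - \<omega> s \<in> X u}"
      and G: "finite G" "G \<subseteq> {s..}" "\<And>u. Y u \<in> sets borel"
      and b: "b = {\<omega>\<in>path_set. \<forall>u\<in>G. \<omega> u - \<omega> s \<in> Y u}"
      unfolding cylinders_def by blast
    have "finite (insert s (F \<union> G))" "insert s (F \<union> G) \<noteq> {}" using F G by auto
    then obtain t :: "nat \<Rightarrow> real" where t: "mono t" "insert s (F \<union> G) \<subseteq> range t"
      by (rule finite_subset_mono_range)
    obtain m where m: "t m = s" using t by blast
    \<comment> \<open>The grid may repeat \<open>s\<close>, and \<open>inv t\<close> could then
      return an index on the wrong side of \<open>m\<close>; hence the index of \<open>s\<close> is
      fixed by hand.\<close>
    define j where "j u = (if u = s then m else inv t u)" for u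
    have j: "t (j u) = u" if "u \<in> F \<union> G" for u
      using that t m by (auto simp: j_def f_inv_into_f)
    have jF: "j u \<le> m" if "u \<in> F" for u
    proof (rule ccontr)
      assume "\<not> j u \<le> m"
      then have "t m \<le> t (j u)" using t by (intro monoD[of t]) auto
      then have "u = s" using j[of u] that F m by auto
      with \<open>\<not> j u \<le> m\<close> show False by (simp add: j_def)
    qed
    have jG: "m \<le> j u" if "u \<in> G" for u
    proof (rule ccontr)
      assume "\<not> m \<le> j u"
      then have "t (j u) \<le> t m" using t by (intro monoD[of t]) auto
      then have "u = s" using j[of u] that G m by auto
      with \<open>\<not> m \<le> j u\<close> show False by (simp add: j_def)
    qed
    define \<Delta> where "\<Delta> i \<omega> = \<omega> (t (Suc i)) - \<omega> (t i)" for i and \<omega> :: "real \<Rightarrow> real"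
    have incr: "increment m (j u) (\<lambda>i. \<Delta> i \<omega>) = \<omega> u - \<omega> s" if "u \<in> F \<union> G" for u \<omega>
      unfolding \<Delta>_def using increment_diff[of m "j u" "\<lambda>i. \<omega> (t i)"] j[OF that] m by simp
    have "{..<m} \<inter> {m..} = {}" by auto
    from indep_var_restrict[OF indep_increments[OF t(1)] this subset_UNIV subset_UNIV]
    have ind: "indep_var (Pi\<^sub>M {..<m} (\<lambda>_. borel)) (\<lambda>\<omega>. restrict (\<lambda>i. \<Delta> i \<omega>) {..<m})
        (Pi\<^sub>M {m..} (\<lambda>_. borel)) (\<lambda>\<omega>. restrict (\<lambda>i. \<Delta> i \<omega>) {m..})"
      unfolding \<Delta>_def .
    define A where "A = {d\<in>space (Pi\<^sub>M {..<m} (\<lambda>_. borel)). \<forall>u\<in>F. increment m (j u) d \<in> X u}"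
    define B where "B = {d\<in>space (Pi\<^sub>M {m..} (\<lambda>_. borel)). \<forall>u\<in>G. increment m (j u) d \<in> Y u}"
    have A: "A \<in> sets (Pi\<^sub>M {..<m} (\<lambda>_. borel))"
      unfolding A_def by (rule sets_increment_cylinder[OF F(1,3)]) (use jF in auto)
    have B: "B \<in> sets (Pi\<^sub>M {m..} (\<lambda>_. borel))"
      unfolding B_def by (rule sets_increment_cylinder[OF G(1,3)]) (use jG in auto)
    have incrF: "increment m (j u) (restrict (\<lambda>i. \<Delta> i \<omega>) {..<m}) = \<omega> u - \<omega> s" if "u \<in> F" for u \<omega>
      using jF[OF that] incr[of u \<omega>] that by (subst increment_restrict) auto
    have incrG: "increment m (j u) (restrict (\<lambda>i. \<Delta> i \<omega>) {m..}) = \<omega> u - \<omega> s" if "u \<in> G" for u \<omega>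
      using jG[OF that] incr[of u \<omega>] that by (subst increment_restrict) auto
    have a': "(\<lambda>\<omega>. restrict (\<lambda>i. \<Delta> i \<omega>) {..<m}) -` A \<inter> space P = a"
      by (auto simp: A_def a space_PiM incrF)
    have b': "(\<lambda>\<omega>. restrict (\<lambda>i. \<Delta> i \<omega>) {m..}) -` B \<inter> space P = b"
      by (auto simp: B_def b space_PiM incrG)
    have "a \<inter> b = (\<lambda>\<omega>. (restrict (\<lambda>i. \<Delta> i \<omega>) {..<m}, restrict (\<lambda>i. \<Delta> i \<omega>) {m..})) -` (A \<times> B) \<inter> space P"
      unfolding a'[symmetric] b'[symmetric] by auto
    then show "prob (a \<inter> b) = prob a * prob b"
      using indep_varD[OF ind A B] a' b' by simp
  qed
  from indep_set_sigma_sets[OF this Int_stable_cylinders Int_stable_cylinders]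
  show ?thesis by (simp only: sets_increment_algebra space_P)
qed

lemma prob_past_future:
  assumes "A \<in> sets (increment_algebra s {..s})" "B \<in> sets (increment_algebra s {s..})"
  shows "prob (A \<inter> B) = prob A * prob B"
  using indep_past_future[of s, unfolded indep_sets2_eq, THEN conjunct2, THEN conjunct2, rule_format, OF assms] .

lemma measurable_shift [measurable]: "shift s \<in> measurable P P"
proof -
  have "shift s \<in> measurable P path_space"
  proof (rule measurable_path_spaceI)
    show "shift s \<omega> \<in> path_set" if "\<omega> \<in> space P" for \<omega> using that by simp
    show "(\<lambda>\<omega>. shift s \<omega> t) \<in> borel_measurable P" for t unfolding shift_def by measurable
  qed
  then show ?thesis by (simp only: measurable_cong_sets[OF refl sets_P])
qed

text \<open>A cylinder involves finitely many consecutive increments. By independence their joint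
  law is a product, and by stationarity no factor changes when the grid is translated; cylinders
  generate the rest.\<close>

lemma distr_shift: "distr P P (shift s) = P"
proof (rule measure_eqI_generator_eq[where \<Omega> = path_set and E = "cylinders 0 UNIV" and A = "\<lambda>_. path_set"])
  show "sets (distr P P (shift s)) = sigma_sets path_set (cylinders 0 UNIV)"
    "sets P = sigma_sets path_set (cylinders 0 UNIV)"
    using sets_P sets_increment_algebra_UNIV sets_increment_algebra by simp_all
  have "path_set \<in> cylinders 0 UNIV"
    unfolding cylinders_def by (intro CollectI exI[of _ "{}"] exI[of _ "\<lambda>_. UNIV"]) simp
  then show "range (\<lambda>_. path_set) \<subseteq> cylinders 0 UNIV" by auto
  interpret D: prob_space "distr P P (shift s)" by (rule prob_space_distr) simp
  show "emeasure (distr P P (shift s)) path_set \<noteq> \<infinity>" by simp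
  fix a assume "a \<in> cylinders 0 UNIV"
  then obtain F X where F: "finite F" "\<And>u. X u \<in> sets borel"
    and a: "a = {\<omega>\<in>path_set. \<forall>u\<in>F. \<omega> u - \<omega> 0 \<in> X u}" unfolding cylinders_def by blast
  have a_sets: "a \<in> sets P"
    using \<open>a \<in> cylinders 0 UNIV\<close> sets_increment_algebra_subset[of 0 UNIV]
    by (auto simp: sets_increment_algebra)
  have "finite (insert 0 F)" "insert 0 F \<noteq> {}" using F by auto
  then obtain t :: "nat \<Rightarrow> real" where t: "mono t" "insert 0 F \<subseteq> range t"
    by (rule finite_subset_mono_range)
  obtain m where m: "t m = 0" using t by force
  define j where "j u = inv t u" for u
  have j: "t (j u) = u" if "u \<in> F" for u
    using that t by (auto simp: j_def f_inv_into_f)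
  \<comment> \<open>The increments over the grid translated by \<open>r\<close>; the cases
    \<open>r = s\<close> and \<open>r = 0\<close> are compared.\<close>
  define \<Delta> where "\<Delta> r i \<omega> = \<omega> (r + t (Suc i)) - \<omega> (r + t i)" for r i and \<omega> :: "real \<Rightarrow> real"
  have incr: "increment m (j u) (\<lambda>i\<in>UNIV. \<Delta> r i \<omega>) = \<omega> (r + u) - \<omega> r" if "u \<in> F" for u \<omega> r
    unfolding \<Delta>_def restrict_UNIV using increment_diff[of m "j u" "\<lambda>i. \<omega> (r + t i)"] j[OF that] m by simp
  define A where "A = {d\<in>space (Pi\<^sub>M UNIV (\<lambda>_. borel)). \<forall>u\<in>F. increment m (j u) d \<in> X u}"
  have A: "A \<in> sets (Pi\<^sub>M UNIV (\<lambda>_. borel))"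
    unfolding A_def by (rule sets_increment_cylinder[OF F]) auto
  have \<Delta>_meas: "\<Delta> r i \<in> borel_measurable P" for r i
    unfolding \<Delta>_def[abs_def] by measurable
  have meas: "(\<lambda>\<omega>. \<lambda>i\<in>UNIV. \<Delta> r i \<omega>) \<in> measurable P (Pi\<^sub>M UNIV (\<lambda>_. borel))" for r
    by (intro measurable_restrict \<Delta>_meas)
  have D: "distr P (Pi\<^sub>M UNIV (\<lambda>_. borel)) (\<lambda>\<omega>. \<lambda>i\<in>UNIV. \<Delta> r i \<omega>)
      = Pi\<^sub>M UNIV (\<lambda>i. distr P borel (\<Delta> r i))" for r
  proof (rule indep_vars_iff_distr_eq_PiM[THEN iffD1])
    show "indep_vars (\<lambda>_. borel) (\<Delta> r) UNIV"
      using indep_increments[of "\<lambda>i. r + t i"] t(1) unfolding \<Delta>_def[abs_def] by (simp add: mono_def)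
  qed (use \<Delta>_meas in auto)
  have eq: "distr P borel (\<Delta> s i) = distr P borel (\<Delta> 0 i)" for i
    unfolding \<Delta>_def[abs_def] using distr_increment[of "t i" "t (Suc i)" s] t(1) by (simp add: mono_def)
  then have "distr P (Pi\<^sub>M UNIV (\<lambda>_. borel)) (\<lambda>\<omega>. \<lambda>i\<in>UNIV. \<Delta> s i \<omega>)
      = distr P (Pi\<^sub>M UNIV (\<lambda>_. borel)) (\<lambda>\<omega>. \<lambda>i\<in>UNIV. \<Delta> 0 i \<omega>)"
    unfolding D by (intro PiM_cong refl eq)
  then have "emeasure P ((\<lambda>\<omega>. \<lambda>i\<in>UNIV. \<Delta> s i \<omega>) -` A \<inter> space P)
      = emeasure P ((\<lambda>\<omega>. \<lambda>i\<in>UNIV. \<Delta> 0 i \<omega>) -` A \<inter> space P)"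
    by (metis emeasure_distr[OF meas A])
  moreover have "(\<lambda>\<omega>. \<lambda>i\<in>UNIV. \<Delta> 0 i \<omega>) -` A \<inter> space P = a"
    by (auto simp: A_def a space_PiM) (use incr[of _ 0] in auto)
  moreover have "(\<lambda>\<omega>. \<lambda>i\<in>UNIV. \<Delta> s i \<omega>) -` A \<inter> space P = shift s -` a \<inter> space P"
    by (auto simp: A_def a space_PiM incr shift_path_set) (auto simp: shift_def)
  ultimately show "emeasure (distr P P (shift s)) a = emeasure P a"
    using a_sets by (simp add: emeasure_distr)
qed (auto simp: Int_stable_cylinders cylinders_subset_Pow)

lemma prob_shift:
  assumes "A \<in> sets P"
  shows "prob (shift s -` A \<inter> space P) = prob A"
  using measure_distr[OF measurable_shift assms, of s] by (simp add: distr_shift)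

end

section \<open>Tubes of positive probability\<close>

text \<open>By right continuity a strict violation at \<open>u < b\<close> persists on an interval
  to the right of \<open>u\<close>, which contains a rational. The end point \<open>b\<close> has no
  room on its right and is added separately.\<close>

lemma path_set_bound_dense:
  assumes "\<omega> \<in> path_set"
    and bound: "\<And>u. u \<in> insert b ({a..b} \<inter> \<rat>) \<Longrightarrow> \<bar>\<omega> u - x\<bar> \<le> r"
    and u: "u \<in> {a..b}"
  shows "\<bar>\<omega> u - x\<bar> \<le> r"
proof (rule ccontr)
  assume "\<not> \<bar>\<omega> u - x\<bar> \<le> r"
  then have large: "\<bar>\<omega> u - x\<bar> > r" by simp
  with bound[of b] u have "u < b" by (cases "u = b") auto
  have "((\<lambda>v. \<bar>\<omega> v - x\<bar>) \<longlongrightarrow> \<bar>\<omega> u - x\<bar>) (at_right u)"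
    by (intro tendsto_intros path_set_right assms(1))
  then have "\<forall>\<^sub>F v in at_right u. \<bar>\<omega> v - x\<bar> > r"
    using large by (rule order_tendstoD(1))
  then obtain d where d: "d > u" "\<And>v. u < v \<Longrightarrow> v < d \<Longrightarrow> \<bar>\<omega> v - x\<bar> > r"
    using \<open>u < b\<close> by (auto simp: eventually_at_right)
  obtain v where "v \<in> \<rat>" "u < v" "v < min b d"
    using Rats_dense_in_real[of u "min b d"] \<open>u < b\<close> d(1) by auto
  then show False using d(2)[of v] bound[of v] u by auto
qed

text \<open>Only increments from \<open>s\<close> enter, which makes the probability independent of
  \<open>s\<close>. The weak inequality in the radius condition lets it be checked on a countable
  dense set of times.\<close>

definition tube :: "real \<Rightarrow> real \<Rightarrow> real \<Rightarrow> real \<Rightarrow> real \<Rightarrow> (real \<Rightarrow> real) set" where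
  "tube s q c r e = {\<omega>\<in>path_set.
     (\<forall>u\<in>{s..s + q}. \<bar>\<omega> u - \<omega> s\<bar> \<le> r) \<and> \<bar>\<omega> (s + q) - \<omega> s - c\<bar> \<le> e}"

text \<open>The reference time \<open>v\<close> cancels in differences, so one tube may be read as
  an event of the past or of the future, whichever algebra observes its interval.\<close>

lemma sets_tube:
  assumes "0 \<le> q" and U: "{s..s + q} \<subseteq> U"
  shows "tube s q c r e \<in> sets (increment_algebra v U)"
proof -
  let ?M = "increment_algebra v U" and ?C = "insert (s + q) ({s..s + q} \<inter> \<rat>)"
  have meas: "(\<lambda>\<omega>. \<omega> u - \<omega> s) \<in> borel_measurable ?M" if "u \<in> {s..s + q}" for u
  proof -
    have "u \<in> U" "s \<in> U" using that U by auto
    then have "(\<lambda>\<omega>. (\<omega> u - \<omega> v) - (\<omega> s - \<omega> v)) \<in> borel_measurable ?M"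
      by (intro borel_measurable_diff[OF measurable_increment measurable_increment])
    moreover have "(\<lambda>\<omega> :: real \<Rightarrow> real. (\<omega> u - \<omega> v) - (\<omega> s - \<omega> v)) = (\<lambda>\<omega>. \<omega> u - \<omega> s)" by auto
    ultimately show ?thesis by metis
  qed
  have "tube s q c r e = {\<omega>\<in>space ?M. \<forall>u\<in>?C. \<bar>\<omega> u - \<omega> s\<bar> \<le> r}
      \<inter> {\<omega>\<in>space ?M. \<bar>\<omega> (s + q) - \<omega> s - c\<bar> \<le> e}"
  proof -
    have "(\<forall>u\<in>{s..s + q}. \<bar>\<omega> u - \<omega> s\<bar> \<le> r) \<longleftrightarrow> (\<forall>u\<in>?C. \<bar>\<omega> u - \<omega> s\<bar> \<le> r)"
      if "\<omega> \<in> path_set" for \<omega>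
    proof
      assume "\<forall>u\<in>{s..s + q}. \<bar>\<omega> u - \<omega> s\<bar> \<le> r"
      then show "\<forall>u\<in>?C. \<bar>\<omega> u - \<omega> s\<bar> \<le> r" using \<open>0 \<le> q\<close> by simp
    next
      assume *: "\<forall>u\<in>?C. \<bar>\<omega> u - \<omega> s\<bar> \<le> r"
      show "\<forall>u\<in>{s..s + q}. \<bar>\<omega> u - \<omega> s\<bar> \<le> r"
        using path_set_bound_dense[OF that bspec[OF *]] by blast
    qed
    then show ?thesis unfolding tube_def by auto
  qed
  also have "\<dots> \<in> sets ?M"
  proof (rule sets.Int)
    have "countable ?C" by (intro countable_insert countable_Int2 countable_rat)
    moreover have "{\<omega>\<in>space ?M. \<bar>\<omega> u - \<omega> s\<bar> \<le> r} \<in> sets ?M" if "u \<in> ?C" for u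
    proof -
      have "u \<in> {s..s + q}" using that \<open>0 \<le> q\<close> by auto
      note [measurable] = meas[OF this]
      show ?thesis by measurable
    qed
    ultimately have "(\<Inter>u\<in>?C. {\<omega>\<in>space ?M. \<bar>\<omega> u - \<omega> s\<bar> \<le> r}) \<in> sets ?M"
      by (intro sets.countable_INT') auto
    then show "{\<omega>\<in>space ?M. \<forall>u\<in>?C. \<bar>\<omega> u - \<omega> s\<bar> \<le> r} \<in> sets ?M"
      by (rule back_subst[of "\<lambda>A. A \<in> sets ?M"]) auto
    have "s + q \<in> {s..s + q}" using \<open>0 \<le> q\<close> by auto
    note [measurable] = meas[OF this]
    show "{\<omega>\<in>space ?M. \<bar>\<omega> (s + q) - \<omega> s - c\<bar> \<le> e} \<in> sets ?M"
      by measurable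
  qed
  finally show ?thesis .
qed

lemma shift_vimage_tube: "shift s -` tube 0 q c r e \<inter> path_set = tube s q c r e"
proof -
  have "(\<forall>u\<in>{0..q}. \<bar>\<omega> (s + u) - \<omega> s\<bar> \<le> r) \<longleftrightarrow> (\<forall>u\<in>{s..s + q}. \<bar>\<omega> u - \<omega> s\<bar> \<le> r)" for \<omega> :: "real \<Rightarrow> real"
  proof safe
    fix u assume *: "\<forall>u\<in>{0..q}. \<bar>\<omega> (s + u) - \<omega> s\<bar> \<le> r" and "u \<in> {s..s + q}"
    then show "\<bar>\<omega> u - \<omega> s\<bar> \<le> r" using *[rule_format, of "u - s"] by simp
  qed auto
  then show ?thesis
    by (auto simp: tube_def shift_path_set) (auto simp: shift_def)
qed

text \<open>The second piece starts within \<open>\<bar>c1\<bar> + e1\<close> of the beginning,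
  which gives the condition on the radius; the errors at the end points add up.\<close>

lemma tube_concat:
  assumes "\<omega> \<in> tube s q1 c1 r1 e1" "\<omega> \<in> tube (s + q1) q2 c2 r2 e2"
    and "r1 \<le> r" "\<bar>c1\<bar> + e1 + r2 \<le> r" "e1 + e2 \<le> e"
  shows "\<omega> \<in> tube s (q1 + q2) (c1 + c2) r e"
proof -
  have 1: "\<omega> \<in> path_set" "\<And>u. u \<in> {s..s + q1} \<Longrightarrow> \<bar>\<omega> u - \<omega> s\<bar> \<le> r1" "\<bar>\<omega> (s + q1) - \<omega> s - c1\<bar> \<le> e1"
    using assms(1) by (auto simp: tube_def)
  have 2: "\<And>u. u \<in> {s + q1..s + q1 + q2} \<Longrightarrow> \<bar>\<omega> u - \<omega> (s + q1)\<bar> \<le> r2"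
    "\<bar>\<omega> (s + q1 + q2) - \<omega> (s + q1) - c2\<bar> \<le> e2"
    using assms(2) by (auto simp: tube_def)
  have "\<bar>\<omega> u - \<omega> s\<bar> \<le> r" if "u \<in> {s..s + (q1 + q2)}" for u
  proof (cases "u \<le> s + q1")
    case True
    then show ?thesis using 1(2)[of u] that assms(3) by simp
  next
    case False
    then have "\<bar>\<omega> u - \<omega> (s + q1)\<bar> \<le> r2" using 2(1)[of u] that by simp
    then show ?thesis using 1(3) assms(4) by linarith
  qed
  moreover have "\<bar>\<omega> (s + (q1 + q2)) - \<omega> s - (c1 + c2)\<bar> \<le> e"
  proof -
    have "s + (q1 + q2) = s + q1 + q2" by simp
    then show ?thesis using 1(3) 2(2) assms(5) by (smt (verit))
  qed
  ultimately show ?thesis using 1(1) by (simp add: tube_def)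
qed

text \<open>Close to \<open>\<tau>\<close> the path is nearly constant on either side. The three
  errors, before the jump, in its size, and after it, account for \<open>3 * e\<close>.\<close>

lemma path_jump_tube:
  assumes \<omega>: "\<omega> \<in> path_set" and \<tau>: "0 < \<tau>" "\<tau> < h" and jump: "\<bar>jump \<omega> \<tau> - b\<bar> \<le> e" and "e > 0"
  shows "\<exists>p\<in>\<rat>. \<exists>q\<in>\<rat>. 0 < p \<and> p < q \<and> q < h \<and> \<omega> \<in> tube p (q - p) b (\<bar>b\<bar> + 3 * e) (3 * e)"
proof -
  obtain l where l: "(\<omega> \<longlongrightarrow> l) (at_left \<tau>)" using path_set_left[OF \<omega>] by blast
  then have "Lim (at_left \<tau>) \<omega> = l" by (intro tendsto_Lim) auto
  with jump have jl: "\<bar>\<omega> \<tau> - l - b\<bar> \<le> e" by (simp add: jump_def)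
  have "\<forall>\<^sub>F v in at_left \<tau>. dist (\<omega> v) l < e"
    using tendstoD[OF l \<open>e > 0\<close>] .
  then obtain d1 where d1: "d1 < \<tau>" "\<And>v. d1 < v \<Longrightarrow> v < \<tau> \<Longrightarrow> dist (\<omega> v) l < e"
    using eventually_at_left[OF \<tau>(1)] by auto
  have "\<forall>\<^sub>F v in at_right \<tau>. dist (\<omega> v) (\<omega> \<tau>) < e"
    using tendstoD[OF path_set_right[OF \<omega>] \<open>e > 0\<close>] .
  then obtain d2 where d2: "\<tau> < d2" "\<And>v. \<tau> < v \<Longrightarrow> v < d2 \<Longrightarrow> dist (\<omega> v) (\<omega> \<tau>) < e"
    using eventually_at_right[OF \<tau>(2)] by auto
  obtain p where p: "p \<in> \<rat>" "max d1 0 < p" "p < \<tau>"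
    using Rats_dense_in_real[of "max d1 0" \<tau>] d1(1) \<tau>(1) by auto
  obtain q where q: "q \<in> \<rat>" "\<tau> < q" "q < min d2 h"
    using Rats_dense_in_real[of \<tau> "min d2 h"] d2(1) \<tau>(2) by auto
  have wp: "\<bar>\<omega> p - l\<bar> < e" using d1(2)[of p] p by (simp add: dist_real_def)
  have after: "\<bar>\<omega> u - \<omega> p - b\<bar> \<le> 3 * e" if "\<tau> \<le> u" "u \<le> q" for u
  proof -
    have "\<bar>\<omega> u - \<omega> \<tau>\<bar> < e"
      using d2(2)[of u] that q \<open>e > 0\<close> by (cases "u = \<tau>") (auto simp: dist_real_def)
    then show ?thesis using wp jl by linarith
  qed
  have "\<bar>\<omega> u - \<omega> p\<bar> \<le> \<bar>b\<bar> + 3 * e" if "u \<in> {p..p + (q - p)}" for u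
  proof (cases "u < \<tau>")
    case True
    then have "\<bar>\<omega> u - l\<bar> < e" using d1(2)[of u] that p by (simp add: dist_real_def)
    then show ?thesis using wp \<open>e > 0\<close> by linarith
  next
    case False
    then show ?thesis using after[of u] that by simp
  qed
  then have "\<omega> \<in> tube p (q - p) b (\<bar>b\<bar> + 3 * e) (3 * e)"
    using after[of q] \<omega> q by (simp add: tube_def)
  then show ?thesis
    using p q by (intro bexI[of _ p] bexI[of _ q]) auto
qed

text \<open>The law of \<open>f\<close> restricted to \<open>A\<close> has nonempty support:
  otherwise each point would have a null neighbourhood, and by the Lindelof property countably many
  of these would cover the line.\<close>

lemma (in prob_space) prob_pos_support_point:
  fixes f :: "'a \<Rightarrow> real"
  assumes A: "A \<in> events" "prob A > 0" and f [measurable]: "f \<in> borel_measurable M"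
  shows "\<exists>y. \<forall>e>0. prob (A \<inter> {x\<in>space M. \<bar>f x - y\<bar> < e}) > 0"
proof (rule ccontr)
  assume "\<nexists>y. \<forall>e>0. prob (A \<inter> {x\<in>space M. \<bar>f x - y\<bar> < e}) > 0"
  then have "\<forall>y. \<exists>e>0. prob (A \<inter> {x\<in>space M. \<bar>f x - y\<bar> < e}) = 0"
    by (metis measure_nonneg order_le_less)
  then obtain e where e: "\<And>y. e y > 0" "\<And>y. prob (A \<inter> {x\<in>space M. \<bar>f x - y\<bar> < e y}) = 0"
    by metis
  have "\<And>S. S \<in> range (\<lambda>y. ball y (e y)) \<Longrightarrow> open S" by auto
  then obtain \<F> where \<F>: "\<F> \<subseteq> range (\<lambda>y. ball y (e y))" "countable \<F>"
    "\<Union>\<F> = \<Union>(range (\<lambda>y. ball y (e y)))"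
    by (rule Lindelof)
  have cover: "\<Union>\<F> = UNIV" using \<F>(3) e(1) by auto
  have null: "A \<inter> f -` S \<in> null_sets M" if S: "S \<in> \<F>" for S
  proof -
    obtain y where "S = ball y (e y)" using S \<F>(1) by auto
    then have "A \<inter> f -` S = A \<inter> {x\<in>space M. \<bar>f x - y\<bar> < e y}"
      using sets.sets_into_space[OF A(1)] by (auto simp: dist_real_def abs_minus_commute)
    moreover have "A \<inter> {x\<in>space M. \<bar>f x - y\<bar> < e y} \<in> events"
      using A(1) by measurable
    ultimately show ?thesis
      using e(2)[of y] by (auto simp: null_sets_def emeasure_eq_measure)
  qed
  have "(\<Union>S\<in>\<F>. A \<inter> f -` S) \<in> null_sets M"
    by (rule null_sets_UN'[OF \<F>(2) null])
  moreover have "(\<Union>S\<in>\<F>. A \<inter> f -` S) = A" using cover by auto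
  ultimately show False using A(2) by (auto simp: null_sets_def emeasure_eq_measure)
qed

section \<open>Steering the noise by small jumps of both signs\<close>

text \<open>The common ground of both noises. The intervals in \<open>charge\<close> avoid 0, where
  the jump measure is infinite, and stay inside the unit interval, where truncation has no
  effect.\<close>

locale levy_jumps = levy +
  assumes sets_\<nu>: "sets \<nu> = sets borel" and sigma_finite_\<nu>: "sigma_finite_measure \<nu>"
    and charge: "\<And>l u. l < u \<Longrightarrow> 0 < l \<and> u < 1 \<or> - 1 < l \<and> u < 0 \<Longrightarrow>
       0 < emeasure \<nu> {l<..<u} \<and> emeasure \<nu> {l<..<u} < \<infinity>"
begin

text \<open>The number of jumps in the box is Poisson with positive finite mean, so it is 0 with
  probability less than 1. Measurability of the event comes from that of
  \<open>jump_count\<close>.\<close>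

lemma jump_event:
  assumes h: "0 < h" and lu: "l < u" "0 < l \<and> u < 1 \<or> - 1 < l \<and> u < 0"
  defines "J \<equiv> {\<omega>\<in>path_set. \<exists>\<tau>. 0 < \<tau> \<and> \<tau> < h \<and> l < jump \<omega> \<tau> \<and> jump \<omega> \<tau> < u}"
  shows "J \<in> events" "prob J > 0"
proof -
  interpret \<nu>: sigma_finite_measure \<nu> by (rule sigma_finite_\<nu>)
  let ?\<mu> = "lborel \<Otimes>\<^sub>M \<nu>" and ?B = "{0<..<h} \<times> {l<..<u}"
  have B: "?B \<in> sets ?\<mu>" by (intro pair_measureI) (auto simp: sets_\<nu>)
  have "emeasure ?\<mu> ?B = emeasure lborel {0<..<h} * emeasure \<nu> {l<..<u}"
    by (intro \<nu>.emeasure_pair_measure_Times) (auto simp: sets_\<nu>)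
  then have \<mu>: "0 < emeasure ?\<mu> ?B" "emeasure ?\<mu> ?B < \<infinity>"
    using charge[OF lu] h by (auto simp: ennreal_mult_less_top ennreal_zero_less_mult_iff)
  have poisson: "poisson_random_measure P jump_count ?\<mu>"
    using law by (simp add: levy_law_def)
  then have meas: "(\<lambda>\<omega>. jump_count \<omega> ?B) \<in> borel_measurable P"
    using B unfolding poisson_random_measure_def by blast
  let ?Z = "{\<omega>\<in>space P. jump_count \<omega> ?B = of_nat 0}"
  have Z: "?Z \<in> events" using meas by measurable
  have "\<forall>k::nat. measure P {\<omega> \<in> space P. jump_count \<omega> ?B = of_nat k}
        = measure ?\<mu> ?B ^ k / fact k * exp (- measure ?\<mu> ?B)"
    using poisson B \<mu>(2) unfolding poisson_random_measure_def by blast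
  then have "prob ?Z = measure ?\<mu> ?B ^ 0 / fact 0 * exp (- measure ?\<mu> ?B)" by (rule spec)
  moreover have "measure ?\<mu> ?B > 0"
    using \<mu> by (simp add: measure_def enn2real_positive_iff)
  ultimately have "prob ?Z < 1" by simp
  then have pos: "prob (space P - ?Z) > 0" using prob_compl[OF Z] by simp
  \<comment> \<open>Since 0 lies outside the interval from \<open>l\<close> to \<open>u\<close>, the
    condition of a nonzero jump in \<open>jump_count\<close> is automatic.\<close>
  have "jump_count \<omega> ?B = 0 \<longleftrightarrow> \<not> (\<exists>\<tau>. 0 < \<tau> \<and> \<tau> < h \<and> l < jump \<omega> \<tau> \<and> jump \<omega> \<tau> < u)" for \<omega>
    using lu unfolding jump_count_def by (subst emeasure_count_space_eq_0) auto
  then have "J = space P - ?Z" by (auto simp: J_def)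
  with sets.compl_sets[OF Z] pos show "J \<in> events" "prob J > 0" by simp_all
qed

lemma tube_events: "0 \<le> q \<Longrightarrow> tube s q c r e \<in> events"
  using sets_tube[of q s UNIV] sets_increment_algebra_subset[of 0 UNIV] by blast

lemma prob_tube_shift: "0 \<le> q \<Longrightarrow> prob (tube s q c r e) = prob (tube 0 q c r e)"
  using prob_shift[OF tube_events[of q 0 c r e], of s] by (simp add: shift_vimage_tube)

text \<open>\<open>block q c r\<close>: paths that stay within \<open>r\<close> up to time \<open>q\<close> and end at \<open>c\<close> are in the
  support of the law. Asking for every tolerance \<open>e\<close> around an exact end point lets blocks be
  concatenated without loss.\<close>

definition block :: "real \<Rightarrow> real \<Rightarrow> real \<Rightarrow> bool" where
  "block q c r \<longleftrightarrow> 0 < q \<and> (\<forall>e>0. prob (tube 0 q c (r + e) e) > 0)"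

text \<open>The two pieces are independent at time \<open>q1\<close>, so their intersection keeps
  positive probability; each piece is run with half of the tolerance.\<close>

lemma block_concat:
  assumes b1: "block q1 c1 r1" and b2: "block q2 c2 r2" and r: "r1 \<le> r" "\<bar>c1\<bar> + r2 \<le> r"
  shows "block (q1 + q2) (c1 + c2) r"
  unfolding block_def
proof (intro conjI allI impI)
  have q: "0 < q1" "0 < q2" using b1 b2 by (auto simp: block_def)
  then show "0 < q1 + q2" by simp
  fix e :: real assume "e > 0"
  let ?A = "tube 0 q1 c1 (r1 + e / 2) (e / 2)" and ?B = "tube q1 q2 c2 (r2 + e / 2) (e / 2)"
  have "prob ?A > 0" "prob ?B > 0"
    using b1 b2 \<open>e > 0\<close> q prob_tube_shift[of q2 q1 c2 "r2 + e / 2" "e / 2"]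
    by (auto simp: block_def)
  moreover have "prob (?A \<inter> ?B) = prob ?A * prob ?B"
    using q by (intro prob_past_future[of _ q1] sets_tube) auto
  ultimately have "0 < prob (?A \<inter> ?B)" by simp
  also have "?A \<inter> ?B \<subseteq> tube 0 (q1 + q2) (c1 + c2) (r + e) e"
    using r \<open>e > 0\<close> by (auto intro: tube_concat[where ?q1.0 = q1 and ?e1.0 = "e / 2" and ?e2.0 = "e / 2"])
  then have "prob (?A \<inter> ?B) \<le> prob (tube 0 (q1 + q2) (c1 + c2) (r + e) e)"
    using q by (intro finite_measure_mono tube_events) auto
  finally show "0 < prob (tube 0 (q1 + q2) (c1 + c2) (r + e) e)" .
qed

text \<open>The interval between two rationals close to a jump time gives a tube around a step function.
  There are countably many such tubes, so one of them has positive probability, and by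
  stationarity it may start at time \<open>0\<close>. In this way the jump need not be separated from the
  rest of the noise.\<close>

lemma block_jump:
  assumes b: "\<bar>b\<bar> < 1" and "0 < e" and "0 < h"
  shows "\<exists>q c. q \<le> h \<and> \<bar>c - b\<bar> \<le> e \<and> block q c (\<bar>b\<bar> + e)"
proof -
  \<comment> \<open>The tube around a jump has error \<open>3 * d\<close>, half of \<open>e\<close>;
    the other half is spent on replacing \<open>b\<close> by the exact end point
    \<open>c\<close>.\<close>
  define d where "d = e / 6"
  have d: "d > 0" "3 * d = e / 2" using \<open>0 < e\<close> by (auto simp: d_def)
  \<comment> \<open>The interval is placed on the side of \<open>b\<close> away from 0, so it
    excludes 0 also when \<open>b = 0\<close>, and short enough to stay inside the unit
    interval.\<close>
  obtain l u where lu: "l < u" "0 < l \<and> u < 1 \<or> - 1 < l \<and> u < 0" "b - d \<le> l" "u \<le> b + d"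
  proof (cases "0 \<le> b")
    case True
    define m where "m = min d (1 - b)"
    have "0 < m" "m \<le> d" "m \<le> 1 - b" using d b by (auto simp: m_def)
    then show ?thesis using True by (intro that[of "b + m / 3" "b + m / 2"]) auto
  next
    case False
    define m where "m = min d (1 + b)"
    have "0 < m" "m \<le> d" "m \<le> 1 + b" using d b by (auto simp: m_def)
    then show ?thesis using False by (intro that[of "b - m / 2" "b - m / 3"]) auto
  qed
  define J where "J = {\<omega>\<in>path_set. \<exists>\<tau>. 0 < \<tau> \<and> \<tau> < h \<and> l < jump \<omega> \<tau> \<and> jump \<omega> \<tau> < u}"
  have J: "J \<in> events" "prob J > 0"
    unfolding J_def by (rule jump_event[OF \<open>0 < h\<close> lu(1,2)])+
  define I where "I = {(p, q). p \<in> \<rat> \<and> q \<in> \<rat> \<and> 0 < p \<and> p < q \<and> q < (h::real)}"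
  define E where "E = (\<lambda>(p, q). tube p (q - p) b (\<bar>b\<bar> + 3 * d) (3 * d))"
  have "\<exists>i\<in>I. prob (E i) > 0"
  proof (rule ccontr)
    assume "\<not> (\<exists>i\<in>I. prob (E i) > 0)"
    then have "prob (E i) = 0" if "i \<in> I" for i
      using that by (meson measure_nonneg order_antisym_conv not_le)
    then have "E i \<in> null_sets P" if "i \<in> I" for i
      using that by (auto simp: null_sets_def emeasure_eq_measure E_def I_def intro!: tube_events)
    moreover have "countable I"
      by (rule countable_subset[of _ "\<rat> \<times> \<rat>"]) (auto simp: I_def countable_rat)
    ultimately have "(\<Union>i\<in>I. E i) \<in> null_sets P" by (intro null_sets_UN')
    moreover have "J \<subseteq> (\<Union>i\<in>I. E i)"
    proof
      fix \<omega> assume "\<omega> \<in> J"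
      then obtain \<tau> where \<tau>: "\<omega> \<in> path_set" "0 < \<tau>" "\<tau> < h" "l < jump \<omega> \<tau>" "jump \<omega> \<tau> < u"
        by (auto simp: J_def)
      have "\<bar>jump \<omega> \<tau> - b\<bar> \<le> d" using \<tau> lu by linarith
      from path_jump_tube[OF \<tau>(1-3) this d(1)] show "\<omega> \<in> (\<Union>i\<in>I. E i)"
        by (force simp: I_def E_def)
    qed
    ultimately have "J \<in> null_sets P" using null_sets_subset[OF _ J(1)] by blast
    then show False using J(2) by (auto simp: null_sets_def emeasure_eq_measure)
  qed
  then obtain p q where pq: "0 < p" "p < q" "q < h" "prob (tube p (q - p) b (\<bar>b\<bar> + 3 * d) (3 * d)) > 0"
    by (auto simp: I_def E_def)
  define A where "A = tube 0 (q - p) b (\<bar>b\<bar> + e / 2) (e / 2)"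
  have A: "A \<in> events" "prob A > 0"
    using pq prob_tube_shift[of "q - p" p] tube_events[of "q - p"] d by (auto simp: A_def)
  \<comment> \<open>The jump gives only a fixed tolerance around \<open>b\<close>. A support point
    of the end value on \<open>A\<close> is a centre at which every tolerance has positive
    probability.\<close>
  obtain c where c: "\<And>e. e > 0 \<Longrightarrow> prob (A \<inter> {\<omega>\<in>space P. \<bar>\<omega> (q - p) - c\<bar> < e}) > 0"
    using prob_pos_support_point[OF A measurable_eval[of "q - p"]] by blast
  have "A \<inter> {\<omega>\<in>space P. \<bar>\<omega> (q - p) - c\<bar> < e / 2} \<noteq> {}"
    using c[of "e / 2"] \<open>0 < e\<close> by (metis half_gt_zero measure_empty order_less_irrefl)
  then obtain \<omega> where "\<omega> \<in> path_set" "\<omega> \<in> A" "\<bar>\<omega> (q - p) - c\<bar> < e / 2" by auto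
  then have "\<bar>\<omega> (q - p) - b\<bar> \<le> e / 2" "\<bar>\<omega> (q - p) - c\<bar> < e / 2" by (simp_all add: A_def tube_def)
  then have "\<bar>c - b\<bar> \<le> e" by linarith
  moreover have "block (q - p) c (\<bar>b\<bar> + e)"
    unfolding block_def
  proof (intro conjI allI impI)
    fix e' :: real assume "e' > 0"
    then have "0 < prob (A \<inter> {\<omega>\<in>space P. \<bar>\<omega> (q - p) - c\<bar> < e'})" by (rule c)
    also have "A \<inter> {\<omega>\<in>space P. \<bar>\<omega> (q - p) - c\<bar> < e'} \<subseteq> tube 0 (q - p) c (\<bar>b\<bar> + e + e') e'"
      using \<open>e' > 0\<close> \<open>0 < e\<close> by (force simp: A_def tube_def)
    then have "prob (A \<inter> {\<omega>\<in>space P. \<bar>\<omega> (q - p) - c\<bar> < e'}) \<le> prob (tube 0 (q - p) c (\<bar>b\<bar> + e + e') e')"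
      using pq by (intro finite_measure_mono tube_events) auto
    finally show "0 < prob (tube 0 (q - p) c (\<bar>b\<bar> + e + e') e')" .
  qed (use pq in simp)
  ultimately show ?thesis using pq by (intro exI[of _ "q - p"] exI[of _ c]) auto
qed

lemma block_steer:
  assumes "0 < e" "0 < h"
  shows "\<exists>q c. q \<le> h \<and> \<bar>c - y\<bar> \<le> e \<and> block q c (\<bar>y\<bar> + e)"
proof -
  obtain k :: nat where k: "\<bar>y\<bar> < real k" using reals_Archimedean2 by blast
  define b where "b = y / real (Suc k)"
  have b: "\<bar>b\<bar> < 1" using k by (simp add: b_def field_simps)
  have "\<exists>q c. q \<le> h \<and> \<bar>c - real (Suc n) * b\<bar> \<le> e \<and> block q c (real (Suc n) * \<bar>b\<bar> + e)"
    if "0 < e" "0 < h" for n :: nat and e h :: real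
    using that
  proof (induction n arbitrary: e h)
    case 0
    then show ?case using block_jump[OF b] by simp
  next
    case (Suc n)
    obtain q1 c1 where 1: "q1 \<le> h / 2" "\<bar>c1 - real (Suc n) * b\<bar> \<le> e / 2"
      "block q1 c1 (real (Suc n) * \<bar>b\<bar> + e / 2)"
      using Suc.IH[of "e / 2" "h / 2"] Suc.prems by auto
    obtain q2 c2 where 2: "q2 \<le> h / 2" "\<bar>c2 - b\<bar> \<le> e / 2" "block q2 c2 (\<bar>b\<bar> + e / 2)"
      using block_jump[OF b, of "e / 2" "h / 2"] Suc.prems by auto
    have *: "real (Suc (Suc n)) * x = real (Suc n) * x + x" for x :: real
      by (simp add: algebra_simps)
    have abs: "\<bar>real (Suc n) * b\<bar> = real (Suc n) * \<bar>b\<bar>" by (simp add: abs_mult)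
    have "\<bar>c1\<bar> \<le> real (Suc n) * \<bar>b\<bar> + e / 2" using 1(2) abs by linarith
    then have "block (q1 + q2) (c1 + c2) (real (Suc (Suc n)) * \<bar>b\<bar> + e)"
      unfolding * using Suc.prems by (intro block_concat[OF 1(3) 2(3)]) auto
    moreover have "\<bar>c1 + c2 - real (Suc (Suc n)) * b\<bar> \<le> e"
      unfolding * using 1(2) 2(2) by linarith
    ultimately show ?case using 1(1) 2(1) by (intro exI[of _ "q1 + q2"] exI[of _ "c1 + c2"]) auto
  qed
  from this[OF assms, of k] show ?thesis
    by (simp add: b_def del: of_nat_Suc)
qed

text \<open>Upward and downward blocks are alternated according to the sign of the current end point.\<close>

lemma block_stay:
  assumes e: "0 < e" "e \<le> 1"
  shows "\<exists>q c. T \<le> q \<and> \<bar>c\<bar> \<le> e \<and> block q c (2 * e)"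
proof -
  \<comment> \<open>The end point \<open>cu\<close> lies between \<open>e / 4\<close> and
    \<open>3 * e / 4\<close>, and \<open>cd\<close> below is its mirror image in kind. Added to a
    \<open>c\<close> of the other sign or zero, either keeps the sum within \<open>e\<close>, and on
    the way the path stays within \<open>e + 3 * e / 4\<close>, less than
    \<open>2 * e\<close>.\<close>
  obtain qu cu where u: "\<bar>cu - e / 2\<bar> \<le> e / 4" "block qu cu (\<bar>e / 2\<bar> + e / 4)"
    using block_jump[of "e / 2" "e / 4" 1] e by auto
  obtain qd cd where d: "\<bar>cd - (- e / 2)\<bar> \<le> e / 4" "block qd cd (\<bar>- e / 2\<bar> + e / 4)"
    using block_jump[of "- e / 2" "e / 4" 1] e by auto
  \<comment> \<open>A lower bound for the duration of each added block, so that enough blocks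
    outlast \<open>T\<close>.\<close>
  define q0 where "q0 = min qu qd"
  have q0: "0 < q0" using u d by (auto simp: q0_def block_def)
  have "\<exists>q c. real (Suc n) * q0 \<le> q \<and> \<bar>c\<bar> \<le> e \<and> block q c (2 * e)" for n
  proof (induction n)
    case 0
    have "prob (tube 0 qu cu (2 * e + e') e') > 0" if "e' > 0" for e'
    proof -
      have "0 < prob (tube 0 qu cu (\<bar>e / 2\<bar> + e / 4 + e') e')"
        using u(2) that by (simp add: block_def)
      also have "\<dots> \<le> prob (tube 0 qu cu (2 * e + e') e')"
        using u(2) e by (intro finite_measure_mono tube_events) (force simp: tube_def block_def)+
      finally show ?thesis .
    qed
    then have "block qu cu (2 * e)" using u(2) by (simp add: block_def)
    moreover have "\<bar>cu\<bar> \<le> e" using u(1) e by linarith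
    ultimately show ?case by (intro exI[of _ qu] exI[of _ cu]) (auto simp: q0_def)
  next
    case (Suc n)
    then obtain q c where qc: "real (Suc n) * q0 \<le> q" "\<bar>c\<bar> \<le> e" "block q c (2 * e)" by blast
    have *: "real (Suc (Suc n)) * q0 = real (Suc n) * q0 + q0" by (simp add: algebra_simps)
    show ?case
    proof (cases "c \<le> 0")
      case True
      have "block (q + qu) (c + cu) (2 * e)"
        using qc(2) e by (intro block_concat[OF qc(3) u(2)]) auto
      moreover have "\<bar>c + cu\<bar> \<le> e" using True qc(2) u(1) e by linarith
      ultimately show ?thesis
        unfolding * using qc(1) by (intro exI[of _ "q + qu"] exI[of _ "c + cu"]) (auto simp: q0_def)
    next
      case False
      have "block (q + qd) (c + cd) (2 * e)"
        using qc(2) e by (intro block_concat[OF qc(3) d(2)]) auto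
      moreover have "\<bar>c + cd\<bar> \<le> e" using False qc(2) d(1) e by linarith
      ultimately show ?thesis
        unfolding * using qc(1) by (intro exI[of _ "q + qd"] exI[of _ "c + cd"]) (auto simp: q0_def)
    qed
  qed
  moreover obtain n :: nat where "T < real n * q0" using ex_less_of_nat_mult[OF q0] by blast
  moreover have "real n * q0 \<le> real (Suc n) * q0" for n :: nat using q0 by simp
  ultimately show ?thesis by (meson less_imp_le order_trans)
qed

end

section \<open>Separation of trajectories\<close>

lemma sde_rds_solves_upto:
  assumes "sde_rds \<beta> \<sigma> \<phi>" "\<omega> \<in> path_set"
  shows "solves_upto \<beta> \<sigma> \<omega> x T (\<lambda>t. \<phi> t \<omega> x)"
  using assms by (intro solves_sde_imp_upto) (simp add: sde_rds_def)

lemma sde_rds_start: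
  assumes "sde_rds \<beta> \<sigma> \<phi>" "\<omega> \<in> path_set"
  shows "\<phi> 0 \<omega> x = x"
  using assms by (simp add: sde_rds_def random_dynamical_system_def)

lemma sde_rds_cocycle:
  assumes "sde_rds \<beta> \<sigma> \<phi>" "\<omega> \<in> path_set" "0 \<le> s" "0 \<le> t"
  shows "\<phi> (t + s) \<omega> x = \<phi> t (shift s \<omega>) (\<phi> s \<omega> x)"
  using assms by (simp add: sde_rds_def random_dynamical_system_def)

lemma sde_rds_contraction:
  assumes "sde_rds \<beta> \<sigma> \<phi>" "\<omega> \<in> path_set" "0 \<le> t"
  shows "\<bar>\<phi> t \<omega> x - \<phi> t \<omega> y\<bar> \<le> exp (\<beta> * t) * \<bar>x - y\<bar>"
  by (rule solves_upto_contraction[OF sde_rds_solves_upto[OF assms(1,2)]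
        sde_rds_solves_upto[OF assms(1,2)] path_set_right[OF assms(2)] assms(3)])

text \<open>The difference of two trajectories is continuous although each may jump, so they cannot
  change order without meeting; by the cocycle property they coincide from then on.\<close>

lemma sde_rds_mono:
  assumes \<phi>: "sde_rds \<beta> \<sigma> \<phi>" and \<omega>: "\<omega> \<in> path_set" and "0 \<le> t" "x \<le> y"
  shows "\<phi> t \<omega> x \<le> \<phi> t \<omega> y"
proof (rule ccontr)
  assume "\<not> \<phi> t \<omega> x \<le> \<phi> t \<omega> y"
  define d where "d u = (\<phi> u \<omega> y - \<sigma> * \<omega> u) - (\<phi> u \<omega> x - \<sigma> * \<omega> u)" for u
  have "continuous_on {0..t} d"
    unfolding d_def[abs_def]
    by (rule continuous_on_diff[OF solves_upto_continuous_on[OF sde_rds_solves_upto[OF \<phi> \<omega>]]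
          solves_upto_continuous_on[OF sde_rds_solves_upto[OF \<phi> \<omega>]]])
  moreover have "d t \<le> 0" using \<open>\<not> \<phi> t \<omega> x \<le> \<phi> t \<omega> y\<close> by (simp add: d_def)
  moreover have "0 \<le> d 0" using \<open>x \<le> y\<close> by (simp add: d_def sde_rds_start[OF \<phi> \<omega>])
  ultimately obtain u where u: "0 \<le> u" "u \<le> t" "d u = 0"
    using IVT2'[of d t 0 0] \<open>0 \<le> t\<close> by blast
  then have "\<phi> u \<omega> x = \<phi> u \<omega> y" by (simp add: d_def)
  then have "\<phi> (t - u + u) \<omega> x = \<phi> (t - u + u) \<omega> y"
    using u by (simp only: sde_rds_cocycle[OF \<phi> \<omega>] diff_ge_0_iff_ge)
  with \<open>\<not> \<phi> t \<omega> x \<le> \<phi> t \<omega> y\<close> show False by simp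
qed

section \<open>Trajectories under a bounded and under a small noise\<close>

text \<open>As long as the barrier has sunk by at most 1 and the continuous part is at most 1 below
  it, the solution is bounded by \<open>M\<close>: this is the 2 in \<open>M\<close>, and
  \<open>R\<close> is the noise. There the drift is at least \<open>- K\<close>, and
  \<open>K * T \<le> 1\<close> closes the circle.\<close>

lemma solves_upto_short_time_lower:
  fixes x R \<beta> :: real
  defines "M \<equiv> \<bar>x\<bar> + 2 + R"
  assumes X: "solves_upto \<beta> \<sigma> \<omega> x T X"
    and right: "\<And>t. (\<omega> \<longlongrightarrow> \<omega> t) (at_right t)" and "0 \<le> T"
    and noise: "\<And>t. 0 \<le> t \<Longrightarrow> t < T \<Longrightarrow> \<bar>\<sigma> * \<omega> t\<bar> \<le> R"
    and K: "\<bar>\<beta>\<bar> * M + M ^ 3 \<le> K" "K * T \<le> 1"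
  shows "x - K * T \<le> X T - \<sigma> * \<omega> T"
proof (cases "T = 0")
  case True
  then show ?thesis using solves_upto_start[OF X] by simp
next
  case False
  with \<open>0 \<le> T\<close> have "0 < T" by simp
  have "0 \<le> R" using noise[of 0] \<open>0 < T\<close> by simp
  then have "0 \<le> M" by (simp add: M_def)
  then have "0 \<le> \<bar>\<beta>\<bar> * M + M ^ 3" by simp
  with K have "0 \<le> K" by linarith
  show ?thesis
  proof (rule solves_upto_lower_bound[OF X right \<open>0 \<le> T\<close>, where \<kappa> = 1])
    fix t z assume t: "0 \<le> t" "t < T" and z: "x - K * t - 1 < z" "z \<le> x - K * t"
    have "0 \<le> K * t" "K * t \<le> K * T" using \<open>0 \<le> K\<close> t by (auto intro: mult_left_mono)
    with z K(2) have "\<bar>z\<bar> \<le> \<bar>x\<bar> + 2" by linarith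
    with noise[OF t] have v: "\<bar>z + \<sigma> * \<omega> t\<bar> \<le> M" unfolding M_def by linarith
    have "\<bar>\<beta> * (z + \<sigma> * \<omega> t)\<bar> \<le> \<bar>\<beta>\<bar> * M"
      unfolding abs_mult using v by (intro mult_left_mono) auto
    moreover have "\<bar>(z + \<sigma> * \<omega> t) ^ 3\<bar> \<le> M ^ 3"
      unfolding power_abs using v by (intro power_mono) auto
    ultimately show "- K \<le> \<beta> * (z + \<sigma> * \<omega> t) - (z + \<sigma> * \<omega> t) ^ 3"
      using K(1) by linarith
  qed auto
qed

text \<open>When the continuous part is between \<open>3 * c / 4\<close> and \<open>c\<close>, the
  solution is between 0 and \<open>2 * c\<close>, where \<open>4 * c\<^sup>2 \<le> \<beta>\<close>
  makes the drift nonnegative. So level \<open>c\<close> is a fixed barrier for the continuous part,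
  whatever the horizon.\<close>

lemma solves_upto_stay_positive:
  assumes X: "solves_upto \<beta> \<sigma> \<omega> x T X"
    and right: "\<And>t. (\<omega> \<longlongrightarrow> \<omega> t) (at_right t)" and "0 \<le> T"
    and noise: "\<And>t. 0 \<le> t \<Longrightarrow> t \<le> T \<Longrightarrow> \<bar>\<sigma> * \<omega> t\<bar> \<le> c / 4"
    and c: "0 < c" "c \<le> x" "4 * c\<^sup>2 \<le> \<beta>"
  shows "c / 2 \<le> X T"
proof -
  have "c - 0 * T \<le> X T - \<sigma> * \<omega> T"
  proof (rule solves_upto_lower_bound[OF X right \<open>0 \<le> T\<close>, where \<kappa> = "c / 4"])
    fix t z assume t: "0 \<le> t" "t < T" and z: "c - 0 * t - c / 4 < z" "z \<le> c - 0 * t"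
    define v where "v = z + \<sigma> * \<omega> t"
    have v: "0 \<le> v" "v \<le> 2 * c" using noise[of t] t z c unfolding v_def by linarith+
    have "v\<^sup>2 \<le> (2 * c)\<^sup>2" using v by (intro power_mono)
    also have "\<dots> \<le> \<beta>" using c by (simp add: power_mult_distrib)
    finally have "0 \<le> v * (\<beta> - v\<^sup>2)" using v by simp
    also have "\<dots> = \<beta> * v - v ^ 3" by (simp add: power2_eq_square power3_eq_cube algebra_simps)
    finally show "- 0 \<le> \<beta> * (z + \<sigma> * \<omega> t) - (z + \<sigma> * \<omega> t) ^ 3" by (simp add: v_def)
  qed (use c in auto)
  then show ?thesis using noise[of T] \<open>0 \<le> T\<close> c by linarith
qed

text \<open>Stopping does not change the solution at time \<open>n\<close>, and the stopped path depends on the noise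
  over \<open>[0, n]\<close> only: this yields the measurability of the pullback with respect to the past.\<close>

definition stop :: "real \<Rightarrow> (real \<Rightarrow> real) \<Rightarrow> real \<Rightarrow> real" where
  "stop n \<omega> u = \<omega> (min (max u 0) n)"

lemma stop_path_set:
  assumes \<omega>: "\<omega> \<in> path_set" and "0 \<le> n"
  shows "stop n \<omega> \<in> path_set"
proof -
  have "(stop n \<omega> \<longlongrightarrow> stop n \<omega> t) (at_right t)" for t
  proof -
    consider "t < 0" | "0 \<le> t" "t < n" | "n \<le> t" by linarith
    then show ?thesis
    proof cases
      case 1
      have "\<forall>\<^sub>F u in at_right t. stop n \<omega> u = stop n \<omega> t"
        using eventually_at_right_real[OF 1] by eventually_elim (use 1 in \<open>auto simp: stop_def\<close>)
      then show ?thesis by (rule tendsto_eventually)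
    next
      case 2
      have "\<forall>\<^sub>F u in at_right t. \<omega> u = stop n \<omega> u"
        using eventually_at_right_real[OF 2(2)] by eventually_elim (use 2 in \<open>auto simp: stop_def\<close>)
      moreover have "stop n \<omega> t = \<omega> t" using 2 by (simp add: stop_def)
      ultimately show ?thesis using path_set_right[OF \<omega>, of t] by (simp add: Lim_transform_eventually)
    next
      case 3
      have "\<forall>\<^sub>F u in at_right t. stop n \<omega> u = stop n \<omega> t"
        using eventually_at_right_less[of t] by eventually_elim (use 3 \<open>0 \<le> n\<close> in \<open>auto simp: stop_def\<close>)
      then show ?thesis by (rule tendsto_eventually)
    qed
  qed
  moreover have "\<exists>l. (stop n \<omega> \<longlongrightarrow> l) (at_left t)" for t
  proof -
    consider "t \<le> 0" | "0 < t" "t \<le> n" | "n < t" by linarith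
    then show ?thesis
    proof cases
      case 1
      have "\<forall>\<^sub>F u in at_left t. stop n \<omega> u = stop n \<omega> t"
        using eventually_at_left_real[of "t - 1" t, simplified]
        by eventually_elim (use 1 in \<open>auto simp: stop_def\<close>)
      then show ?thesis by (intro exI) (rule tendsto_eventually)
    next
      case 2
      have "\<forall>\<^sub>F u in at_left t. \<omega> u = stop n \<omega> u"
        using eventually_at_left_real[OF 2(1)] by eventually_elim (use 2 in \<open>auto simp: stop_def\<close>)
      moreover obtain l where "(\<omega> \<longlongrightarrow> l) (at_left t)" using path_set_left[OF \<omega>] by blast
      ultimately show ?thesis by (intro exI[of _ l]) (rule Lim_transform_eventually)
    next
      case 3
      have "\<forall>\<^sub>F u in at_left t. stop n \<omega> u = stop n \<omega> t"
        using eventually_at_left_real[OF 3] by eventually_elim (use 3 \<open>0 \<le> n\<close> in \<open>auto simp: stop_def\<close>)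
      then show ?thesis by (intro exI) (rule tendsto_eventually)
    qed
  qed
  ultimately show ?thesis
    using \<omega> \<open>0 \<le> n\<close> unfolding path_set_def cadlag_def by (simp add: stop_def)
qed

lemma sde_rds_stop:
  assumes \<phi>: "sde_rds \<beta> \<sigma> \<phi>" and \<omega>: "\<omega> \<in> path_set" and "0 \<le> n"
  shows "\<phi> n (stop n \<omega>) x = \<phi> n \<omega> x"
proof -
  have "solves_upto \<beta> \<sigma> (stop n \<omega>) x n (\<lambda>t. \<phi> t (stop n \<omega>) x)"
    by (rule sde_rds_solves_upto[OF \<phi> stop_path_set[OF \<omega> \<open>0 \<le> n\<close>]])
  \<comment> \<open>The two paths agree on \<open>{0..n}\<close>, so both trajectories solve the
    same equation there and uniqueness applies.\<close>
  then have "solves_upto \<beta> \<sigma> \<omega> x n (\<lambda>t. \<phi> t (stop n \<omega>) x)"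
    by (simp add: solves_upto_def stop_def)
  from solves_upto_contraction[OF this sde_rds_solves_upto[OF \<phi> \<omega>, of x] path_set_right[OF \<omega>] \<open>0 \<le> n\<close>]
  show ?thesis by simp
qed

lemma pullback_measurable_past:
  assumes \<phi>: "sde_rds \<beta> \<sigma> \<phi>" and "0 \<le> n"
  shows "(\<lambda>\<omega>. \<phi> n (shift (- n) \<omega>) x) \<in> borel_measurable (increment_algebra 0 {..0})"
proof -
  let ?M = "increment_algebra 0 {..0}" and ?\<kappa> = "\<lambda>\<omega>. stop n (shift (- n) \<omega>)"
  have \<kappa>: "?\<kappa> \<in> measurable ?M path_space"
  proof (rule measurable_path_spaceI)
    show "?\<kappa> \<omega> \<in> path_set" if "\<omega> \<in> space ?M" for \<omega>
      using that \<open>0 \<le> n\<close> by (intro stop_path_set shift_path_set) simp_all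
    fix t
    define v where "v = min (max t 0) n"
    \<comment> \<open>After the shift by \<open>- n\<close>, the stopped path reads the noise only
      at times between \<open>- n\<close> and 0.\<close>
    have "- n + v \<in> {..0}" "- n \<in> {..0}" using \<open>0 \<le> n\<close> by (auto simp: v_def)
    then have "(\<lambda>\<omega>. (\<omega> (- n + v) - \<omega> 0) - (\<omega> (- n) - \<omega> 0)) \<in> borel_measurable ?M"
      by (intro borel_measurable_diff[OF measurable_increment measurable_increment])
    moreover have "(\<lambda>\<omega>. (\<omega> (- n + v) - \<omega> 0) - (\<omega> (- n) - \<omega> 0)) = (\<lambda>\<omega>. ?\<kappa> \<omega> t)"
      by (auto simp: stop_def shift_def v_def)
    ultimately show "(\<lambda>\<omega>. ?\<kappa> \<omega> t) \<in> borel_measurable ?M" by metis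
  qed
  have "(\<lambda>(t, \<omega>, x). \<phi> t \<omega> x)
      \<in> borel_measurable (restrict_space borel {0..} \<Otimes>\<^sub>M path_space \<Otimes>\<^sub>M borel)"
    using \<phi> by (simp add: sde_rds_def random_dynamical_system_def)
  moreover have "(\<lambda>\<omega>. (n, ?\<kappa> \<omega>, x)) \<in> measurable ?M (restrict_space borel {0..} \<Otimes>\<^sub>M path_space \<Otimes>\<^sub>M borel)"
    using \<open>0 \<le> n\<close> by (intro measurable_Pair \<kappa> measurable_const) (auto simp: space_restrict_space)
  ultimately have "(\<lambda>\<omega>. case (n, ?\<kappa> \<omega>, x) of (t, \<omega>, x) \<Rightarrow> \<phi> t \<omega> x) \<in> borel_measurable ?M"
    by (rule measurable_compose[rotated])
  then have "(\<lambda>\<omega>. \<phi> n (?\<kappa> \<omega>) x) \<in> borel_measurable ?M" by (simp only: prod.case)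
  moreover have "(\<lambda>\<omega>. \<phi> n (?\<kappa> \<omega>) x) \<in> borel_measurable ?M
      \<longleftrightarrow> (\<lambda>\<omega>. \<phi> n (shift (- n) \<omega>) x) \<in> borel_measurable ?M"
    using sde_rds_stop[OF \<phi> shift_path_set \<open>0 \<le> n\<close>] by (intro measurable_cong) simp
  ultimately show ?thesis by (rule iffD1[rotated])
qed

section \<open>Failure of uniform attraction for positive \<open>\<beta>\<close>\<close>

context levy_jumps
begin

text \<open>First the noise moves by about \<open>- y / \<sigma>\<close> in a time so short that the
  drift hardly acts, which takes \<open>y + r\<close> and \<open>y - r\<close> to about
  \<open>r\<close> and \<open>- r\<close>. Then it stays still for as long as desired, and the two
  trajectories are trapped on opposite sides of 0. The distance \<open>c\<close> is fixed before
  \<open>T0\<close>.\<close>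

lemma separation:
  assumes \<phi>: "sde_rds \<beta> \<sigma> \<phi>" and "\<beta> > 0" "\<sigma> \<noteq> 0" "r > 0"
  shows "\<exists>c>0. \<forall>T0. \<exists>T\<ge>T0. \<exists>G\<in>sets (increment_algebra 0 {0..}). 0 \<le> T \<and> prob G > 0 \<and>
    (\<forall>\<omega>\<in>G. c \<le> \<phi> T \<omega> (y + r) - \<phi> T \<omega> (y - r))"
proof -
  \<comment> \<open>The bound \<open>r / 4\<close> lies safely below the position reached in the
    first phase; the bound by the root gives \<open>4 * c\<^sup>2 \<le> \<beta>\<close> for the
    second.\<close>
  define c where "c = min (r / 4) (sqrt \<beta> / 2)"
  have c: "0 < c" "c \<le> r / 4" using assms by (auto simp: c_def)
  have "c\<^sup>2 \<le> (sqrt \<beta> / 2)\<^sup>2" using c(1) by (intro power_mono) (auto simp: c_def)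
  then have c\<beta>: "4 * c\<^sup>2 \<le> \<beta>" using \<open>\<beta> > 0\<close> by (simp add: power_divide)
  \<comment> \<open>The noise misses its target by at most \<open>2 * e\<close>, which displaces the
    solution by at most \<open>r / 8\<close>.\<close>
  define e where "e = r / (16 * \<bar>\<sigma>\<bar>)"
  have e: "0 < e" "\<bar>\<sigma>\<bar> * (2 * e) = r / 8" using assms by (auto simp: e_def)
  define R where "R = \<bar>\<sigma>\<bar> * (\<bar>- y / \<sigma>\<bar> + 2 * e)"
  have "0 \<le> R" using e(1) by (simp add: R_def)
  \<comment> \<open>The constants of the short-time estimate, taken large enough for both starting
    points.\<close>
  define M where "M = \<bar>y\<bar> + r + 2 + R"
  define K where "K = \<bar>\<beta>\<bar> * M + M ^ 3"
  have "0 < M" using \<open>0 \<le> R\<close> \<open>r > 0\<close> by (simp add: M_def)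
  then have "0 < K" by (simp add: K_def add_nonneg_pos)
  \<comment> \<open>The first bound is what the short-time estimate asks for; the second limits the
    drift during the first phase to \<open>r / 8\<close>.\<close>
  define h where "h = min (1 / K) (r / (8 * K))"
  have "0 < h" using \<open>0 < K\<close> \<open>r > 0\<close> by (simp add: h_def)
  have h: "K * q \<le> 1" "K * q \<le> r / 8" if "q \<le> h" for q
    using that \<open>0 < K\<close> by (auto simp: h_def field_simps)
  obtain q1 c1 where 1: "q1 \<le> h" "\<bar>c1 - - y / \<sigma>\<bar> \<le> e" "block q1 c1 (\<bar>- y / \<sigma>\<bar> + e)"
    using block_steer[OF e(1) \<open>0 < h\<close>, of "- y / \<sigma>"] by blast
  have "0 < q1" using 1(3) by (simp add: block_def)
  \<comment> \<open>In the second phase the path stays within \<open>2 * e2 + e2\<close>, so the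
    noise stays within the \<open>c / 4\<close> that trapping permits; the 1 is the limit on
    \<open>e\<close> in \<open>block_stay\<close>.\<close>
  define e2 where "e2 = min 1 (c / (12 * \<bar>\<sigma>\<bar>))"
  have e2: "0 < e2" "e2 \<le> 1" "\<bar>\<sigma>\<bar> * (3 * e2) \<le> c / 4"
    using c assms by (auto simp: e2_def min_def field_simps)
  have "\<exists>T\<ge>T0. \<exists>G\<in>sets (increment_algebra 0 {0..}). 0 \<le> T \<and> prob G > 0 \<and>
    (\<forall>\<omega>\<in>G. c \<le> \<phi> T \<omega> (y + r) - \<phi> T \<omega> (y - r))" for T0
  proof -
    obtain q2 c2 where 2: "T0 \<le> q2" "block q2 c2 (2 * e2)"
      using block_stay[OF e2(1,2)] by blast
    have "0 < q2" using 2(2) by (simp add: block_def)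
    define A where "A = tube 0 q1 c1 (\<bar>- y / \<sigma>\<bar> + e + e) e"
    define B where "B = tube q1 q2 c2 (2 * e2 + e2) e2"
    have "prob A > 0"
      using 1(3) e(1) unfolding A_def block_def by blast
    moreover have "prob (tube 0 q2 c2 (2 * e2 + e2) e2) > 0"
      using 2(2) e2(1) unfolding block_def by blast
    then have "prob B > 0"
      unfolding B_def using prob_tube_shift[of q2 q1 c2 "2 * e2 + e2" e2] \<open>0 < q2\<close> by simp
    moreover have "prob (A \<inter> B) = prob A * prob B"
      unfolding A_def B_def using \<open>0 < q1\<close> \<open>0 < q2\<close>
      by (intro prob_past_future[of _ q1] sets_tube) auto
    ultimately have "prob (A \<inter> B) > 0" by simp
    moreover have "A \<inter> B \<in> sets (increment_algebra 0 {0..})"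
      unfolding A_def B_def using \<open>0 < q1\<close> \<open>0 < q2\<close> by (intro sets.Int sets_tube) auto
    moreover have "c \<le> \<phi> (q2 + q1) \<omega> (y + r) - \<phi> (q2 + q1) \<omega> (y - r)" if \<omega>AB: "\<omega> \<in> A \<inter> B" for \<omega>
    proof -
      have \<omega>: "\<omega> \<in> path_set" using \<omega>AB by (simp add: A_def tube_def)
      have A: "\<bar>\<omega> t\<bar> \<le> \<bar>- y / \<sigma>\<bar> + 2 * e" if "0 \<le> t" "t \<le> q1" for t
      proof -
        have "\<forall>u\<in>{0..q1}. \<bar>\<omega> u\<bar> \<le> \<bar>- y / \<sigma>\<bar> + e + e"
          using \<omega>AB \<omega> by (simp add: A_def tube_def)
        then have "\<bar>\<omega> t\<bar> \<le> \<bar>- y / \<sigma>\<bar> + e + e" by (rule bspec) (use that in simp)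
        then show ?thesis by linarith
      qed
      have "\<bar>\<omega> q1 - c1\<bar> \<le> e" using \<omega>AB \<omega> by (simp add: A_def tube_def)
      then have "\<bar>\<omega> q1 - - y / \<sigma>\<bar> \<le> 2 * e" using 1(2) by linarith
      then have "\<bar>\<sigma>\<bar> * \<bar>\<omega> q1 - - y / \<sigma>\<bar> \<le> \<bar>\<sigma>\<bar> * (2 * e)" by (intro mult_left_mono) auto
      also have "\<bar>\<sigma>\<bar> * \<bar>\<omega> q1 - - y / \<sigma>\<bar> = \<bar>\<sigma> * \<omega> q1 + y\<bar>"
        using \<open>\<sigma> \<noteq> 0\<close> by (simp add: abs_mult[symmetric] algebra_simps)
      finally have end1: "\<bar>\<sigma> * \<omega> q1 + y\<bar> \<le> r / 8" unfolding e(2) .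
      have noise1: "\<bar>\<sigma> * \<omega> t\<bar> \<le> R" if "0 \<le> t" "t < q1" for t
        unfolding R_def abs_mult using A[of t] that by (intro mult_left_mono) auto
      have MK: "\<bar>\<beta>\<bar> * (\<bar>x\<bar> + 2 + R) + (\<bar>x\<bar> + 2 + R) ^ 3 \<le> K" if "\<bar>x\<bar> \<le> \<bar>y\<bar> + r" for x
        unfolding K_def M_def using that \<open>0 \<le> R\<close>
        by (intro add_mono mult_left_mono power_mono) auto
      have "y + r - K * q1 \<le> \<phi> q1 \<omega> (y + r) - \<sigma> * \<omega> q1"
        using \<open>0 < q1\<close> \<open>r > 0\<close> h(1)[OF 1(1)]
        by (intro solves_upto_short_time_lower[OF sde_rds_solves_upto[OF \<phi> \<omega>]
              path_set_right[OF \<omega>] _ noise1 MK]) auto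
      then have up: "c \<le> \<phi> q1 \<omega> (y + r)"
        using end1 h(2)[OF 1(1)] c(2) \<open>r > 0\<close> by linarith
      \<comment> \<open>The lower trajectory is handled by reflection: its negative solves the
        equation with \<open>- \<sigma>\<close>.\<close>
      have "- (y - r) - K * q1 \<le> - \<phi> q1 \<omega> (y - r) - (- \<sigma>) * \<omega> q1"
        using \<open>0 < q1\<close> \<open>r > 0\<close> h(1)[OF 1(1)] noise1
        by (intro solves_upto_short_time_lower[OF solves_upto_uminus[OF sde_rds_solves_upto[OF \<phi> \<omega>]]
              path_set_right[OF \<omega>] _ _ MK]) auto
      then have down: "c \<le> - \<phi> q1 \<omega> (y - r)"
        using end1 h(2)[OF 1(1)] c(2) \<open>r > 0\<close> by linarith
      let ?\<omega> = "shift q1 \<omega>"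
      have \<omega>': "?\<omega> \<in> path_set" using \<omega> by simp
      have noise2: "\<bar>\<sigma> * ?\<omega> t\<bar> \<le> c / 4" if "0 \<le> t" "t \<le> q2" for t
      proof -
        have "\<bar>?\<omega> t\<bar> \<le> 3 * e2" using \<omega>AB that by (auto simp: B_def tube_def shift_def)
        then have "\<bar>\<sigma>\<bar> * \<bar>?\<omega> t\<bar> \<le> \<bar>\<sigma>\<bar> * (3 * e2)" by (intro mult_left_mono) auto
        then show ?thesis using e2(3) by (simp add: abs_mult)
      qed
      have "c / 2 \<le> \<phi> q2 ?\<omega> (\<phi> q1 \<omega> (y + r))"
        using \<open>0 < q2\<close> noise2 up c(1) c\<beta>
        by (intro solves_upto_stay_positive[OF sde_rds_solves_upto[OF \<phi> \<omega>'] path_set_right[OF \<omega>']]) auto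
      moreover have "c / 2 \<le> - \<phi> q2 ?\<omega> (\<phi> q1 \<omega> (y - r))"
        using \<open>0 < q2\<close> noise2 down c(1) c\<beta>
        by (intro solves_upto_stay_positive[OF solves_upto_uminus[OF sde_rds_solves_upto[OF \<phi> \<omega>']]
              path_set_right[OF \<omega>']]) auto
      ultimately show ?thesis
        using \<open>0 < q1\<close> \<open>0 < q2\<close> by (simp add: sde_rds_cocycle[OF \<phi> \<omega>])
    qed
    ultimately show ?thesis
      using 2(1) \<open>0 < q1\<close> \<open>0 < q2\<close> by (intro exI[of _ "q2 + q1"] conjI bexI[of _ "A \<inter> B"]) auto
  qed
  with c(1) show ?thesis by blast
qed

lemma not_locally_uniformly_attractive:
  assumes \<phi>: "sde_rds \<beta> \<sigma> \<phi>" and "\<beta> > 0" "\<sigma> \<noteq> 0"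
    and a: "attracting_random_equilibrium P \<phi> a" and "\<delta> > 0"
  shows "\<not> ((\<lambda>t. SUP x\<in>{- \<delta><..<\<delta>}.
      esssup P (\<lambda>\<omega>. ennreal \<bar>\<phi> t \<omega> (a \<omega> + x) - a (shift t \<omega>)\<bar>)) \<longlongrightarrow> 0) at_top"
proof
  assume lim: "((\<lambda>t. SUP x\<in>{- \<delta><..<\<delta>}.
      esssup P (\<lambda>\<omega>. ennreal \<bar>\<phi> t \<omega> (a \<omega> + x) - a (shift t \<omega>)\<bar>)) \<longlongrightarrow> 0) at_top"
  have a_meas [measurable]: "a \<in> borel_measurable P"
    using a by (simp add: attracting_random_equilibrium_def)
  let ?Past = "increment_algebra 0 {..0}"
  define Y where "Y n \<omega> = \<phi> (real n) (shift (- real n) \<omega>) 0" for n \<omega>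
  \<comment> \<open>A version of \<open>a\<close> that is measurable with respect to the past: the
    pullback limit from 0 along integer times.\<close>
  define a' where "a' \<omega> = lim (\<lambda>n. Y n \<omega>)" for \<omega>
  have [measurable]: "Y n \<in> borel_measurable ?Past" for n
    unfolding Y_def[abs_def] by (rule pullback_measurable_past[OF \<phi>]) simp
  have a'_meas: "a' \<in> borel_measurable ?Past" unfolding a'_def[abs_def] by measurable
  have "AE \<omega> in P. \<forall>B. bounded B \<longrightarrow>
      ((\<lambda>t. SUP x\<in>B. ennreal \<bar>\<phi> t (shift (- t) \<omega>) x - a \<omega>\<bar>) \<longlongrightarrow> 0) at_top"
    using a by (auto simp: attracting_random_equilibrium_def)
  then have a_eq: "AE \<omega> in P. a' \<omega> = a \<omega>"
  proof eventually_elim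
    case (elim \<omega>)
    then have "((\<lambda>t. ennreal \<bar>\<phi> t (shift (- t) \<omega>) 0 - a \<omega>\<bar>) \<longlongrightarrow> 0) at_top"
      by (auto dest: spec[of _ "{0}"])
    from filterlim_compose[OF this filterlim_real_sequentially]
    have "(\<lambda>n. ennreal \<bar>Y n \<omega> - a \<omega>\<bar>) \<longlonglongrightarrow> ennreal 0" by (simp add: Y_def)
    then have "(\<lambda>n. \<bar>Y n \<omega> - a \<omega>\<bar>) \<longlonglongrightarrow> 0" by (subst (asm) tendsto_ennreal_iff) auto
    then have "(\<lambda>n. Y n \<omega>) \<longlonglongrightarrow> a \<omega>" by (simp add: tendsto_rabs_zero_iff LIM_zero_iff)
    then show ?case unfolding a'_def by (rule limI)
  qed
  obtain y where y: "\<And>e. e > 0 \<Longrightarrow> prob (space P \<inter> {\<omega>\<in>space P. \<bar>a \<omega> - y\<bar> < e}) > 0"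
    using prob_pos_support_point[OF sets.top _ a_meas] by (auto simp: prob_space simp del: space_P)
  \<comment> \<open>Then \<open>2 * r < \<delta>\<close>, and if \<open>a \<omega>\<close> is within
    \<open>r\<close> of \<open>y\<close>, the points \<open>a \<omega> + 2 * r\<close> and
    \<open>a \<omega> - 2 * r\<close> enclose \<open>y + r\<close> and \<open>y - r\<close>.\<close>
  define r where "r = \<delta> / 4"
  have "r > 0" using \<open>\<delta> > 0\<close> by (simp add: r_def)
  from separation[OF \<phi> \<open>\<beta> > 0\<close> \<open>\<sigma> \<noteq> 0\<close> this, of y] obtain c where c: "c > 0"
    and sep: "\<And>T0. \<exists>T\<ge>T0. \<exists>G\<in>sets (increment_algebra 0 {0..}). 0 \<le> T \<and> prob G > 0 \<and>
      (\<forall>\<omega>\<in>G. c \<le> \<phi> T \<omega> (y + r) - \<phi> T \<omega> (y - r))" by blast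
  \<comment> \<open>Two trajectories within \<open>c / 3\<close> of the equilibrium are less than
    \<open>c\<close> apart, against the separation.\<close>
  have "0 < ennreal (c / 3)" using c by simp
  from order_tendstoD(2)[OF lim this] obtain T0 where T0: "\<And>t. t \<ge> T0 \<Longrightarrow>
      (SUP x\<in>{- \<delta><..<\<delta>}. esssup P (\<lambda>\<omega>. ennreal \<bar>\<phi> t \<omega> (a \<omega> + x) - a (shift t \<omega>)\<bar>)) < ennreal (c / 3)"
    by (auto simp: eventually_at_top_linorder)
  obtain T G where T: "T \<ge> T0" "0 \<le> T" and G: "G \<in> sets (increment_algebra 0 {0..})" "prob G > 0"
    "\<And>\<omega>. \<omega> \<in> G \<Longrightarrow> c \<le> \<phi> T \<omega> (y + r) - \<phi> T \<omega> (y - r)"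
    using sep[of T0] by blast
  have close: "AE \<omega> in P. \<bar>\<phi> T \<omega> (a \<omega> + x) - a (shift T \<omega>)\<bar> < c / 3" if x: "x \<in> {- \<delta><..<\<delta>}" for x
  proof -
    let ?f = "\<lambda>\<omega>. ennreal \<bar>\<phi> T \<omega> (a \<omega> + x) - a (shift T \<omega>)\<bar>"
    have "esssup P ?f \<le> (SUP x\<in>{- \<delta><..<\<delta>}. esssup P (\<lambda>\<omega>. ennreal \<bar>\<phi> T \<omega> (a \<omega> + x) - a (shift T \<omega>)\<bar>))"
      using x by (rule SUP_upper)
    also have "\<dots> < ennreal (c / 3)" by (rule T0[OF T(1)])
    finally have "esssup P ?f < ennreal (c / 3)" .
    with esssup_AE[of ?f P] have "AE \<omega> in P. ?f \<omega> < ennreal (c / 3)"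
      by (auto elim: eventually_mono)
    then show ?thesis by (auto simp: ennreal_less_iff elim: eventually_mono)
  qed
  \<comment> \<open>Using \<open>a'\<close> instead of \<open>a\<close> makes this an event of the
    past, independent of \<open>G\<close>.\<close>
  define A where "A = {\<omega>\<in>space ?Past. \<bar>a' \<omega> - y\<bar> < r}"
  have A: "A \<in> sets ?Past" unfolding A_def using a'_meas by measurable
  have AP: "A \<in> events" "G \<in> events"
    using A G(1) sets_increment_algebra_subset by blast+
  have "prob A = prob {\<omega>\<in>space P. \<bar>a \<omega> - y\<bar> < r}"
  proof (rule measure_eq_AE)
    show "AE \<omega> in P. (\<omega> \<in> A) = (\<omega> \<in> {\<omega>\<in>space P. \<bar>a \<omega> - y\<bar> < r})"
      using a_eq by eventually_elim (simp add: A_def)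
  qed (use AP in measurable)
  also have "\<dots> > 0" using y[OF \<open>r > 0\<close>] by (simp add: Int_absorb1)
  finally have "prob A > 0" .
  with prob_past_future[OF A G(1)] G(2) have "prob (A \<inter> G) > 0" by simp
  moreover have d: "2 * r \<in> {- \<delta><..<\<delta>}" "- 2 * r \<in> {- \<delta><..<\<delta>}"
    using \<open>\<delta> > 0\<close> by (auto simp: r_def)
  have "AE \<omega> in P. \<omega> \<notin> A \<inter> G"
    using close[OF d(1)] close[OF d(2)] a_eq AE_space
  proof eventually_elim
    case (elim \<omega>)
    show ?case
    proof
      assume \<omega>: "\<omega> \<in> A \<inter> G"
      then have p: "\<omega> \<in> path_set" "\<bar>a \<omega> - y\<bar> < r" using elim by (auto simp: A_def)
      have "\<phi> T \<omega> (y + r) \<le> \<phi> T \<omega> (a \<omega> + 2 * r)" "\<phi> T \<omega> (a \<omega> + - 2 * r) \<le> \<phi> T \<omega> (y - r)"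
        using p(2) by (auto intro!: sde_rds_mono[OF \<phi> p(1) T(2)])
      moreover have "c \<le> \<phi> T \<omega> (y + r) - \<phi> T \<omega> (y - r)" using G(3) \<omega> by blast
      moreover have "\<bar>\<phi> T \<omega> (a \<omega> + 2 * r) - a (shift T \<omega>)\<bar> < c / 3"
        "\<bar>\<phi> T \<omega> (a \<omega> + - 2 * r) - a (shift T \<omega>)\<bar> < c / 3"
        using elim(1,2) by auto
      ultimately show False using c by linarith
    qed
  qed
  then have "prob (A \<inter> G) = 0" using AP by (subst prob_eq_0) auto
  ultimately show False by simp
qed

end

section \<open>The stable jump measures\<close>

lemma stable_const_pos: "0 < \<alpha> \<Longrightarrow> \<alpha> < 2 \<Longrightarrow> 0 < stable_const \<alpha>"
  unfolding stable_const_def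
  by (intro mult_pos_pos divide_pos_pos Gamma_real_pos) auto

lemma sets_stable_measure [simp, measurable_cong]: "sets (stable_measure \<alpha>) = sets borel"
  by (simp add: stable_measure_def)

text \<open>On the interval \<open>\<bar>z\<bar>\<close> lies between some \<open>m > 0\<close> and
  1, so the density lies between \<open>stable_const \<alpha>\<close> and
  \<open>stable_const \<alpha> * m powr (- 1 - \<alpha>)\<close>.\<close>

lemma stable_measure_charge:
  assumes \<alpha>: "0 < \<alpha>" "\<alpha> < 2" and lu: "l < u" "0 < l \<and> u < 1 \<or> - 1 < l \<and> u < 0"
  shows "0 < emeasure (stable_measure \<alpha>) {l<..<u}" "emeasure (stable_measure \<alpha>) {l<..<u} < \<infinity>"
proof -
  let ?k = "stable_const \<alpha>" and ?f = "\<lambda>z::real. ennreal (stable_const \<alpha> * \<bar>z\<bar> powr (- 1 - \<alpha>))"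
  have k: "0 < ?k" using stable_const_pos \<alpha> by simp
  define m where "m = min \<bar>l\<bar> \<bar>u\<bar>"
  have m: "0 < m" using lu by (auto simp: m_def)
  have z: "m \<le> \<bar>z\<bar>" "\<bar>z\<bar> \<le> 1" "z \<noteq> 0" if "z \<in> {l<..<u}" for z
    using that lu by (auto simp: m_def)
  have eq: "emeasure (stable_measure \<alpha>) {l<..<u} = (\<integral>\<^sup>+z. ?f z * indicator {l<..<u} z \<partial>lborel)"
    unfolding stable_measure_def by (rule emeasure_density) auto
  have "0 < ennreal ?k * emeasure lborel {l<..<u}"
    using k lu by (simp add: ennreal_zero_less_mult_iff)
  also have "\<dots> = (\<integral>\<^sup>+z. ennreal ?k * indicator {l<..<u} z \<partial>lborel)"
    by (simp add: nn_integral_cmult_indicator)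
  also have "\<dots> \<le> (\<integral>\<^sup>+z. ?f z * indicator {l<..<u} z \<partial>lborel)"
  proof (rule nn_integral_mono)
    fix x :: real
    have "?k \<le> ?k * \<bar>x\<bar> powr (- 1 - \<alpha>)" if "x \<in> {l<..<u}"
    proof -
      have "\<bar>x\<bar> powr 0 \<le> \<bar>x\<bar> powr (- 1 - \<alpha>)" using z[OF that] \<alpha> by (intro powr_mono') auto
      then have "1 \<le> \<bar>x\<bar> powr (- 1 - \<alpha>)" using z[OF that] by simp
      then show ?thesis using k by simp
    qed
    then show "ennreal ?k * indicator {l<..<u} x \<le> ?f x * indicator {l<..<u} x"
      by (auto simp: indicator_def intro: ennreal_leI)
  qed
  finally show "0 < emeasure (stable_measure \<alpha>) {l<..<u}" unfolding eq .
  have "(\<integral>\<^sup>+z. ?f z * indicator {l<..<u} z \<partial>lborel)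
      \<le> (\<integral>\<^sup>+z. ennreal (?k * m powr (- 1 - \<alpha>)) * indicator {l<..<u} z \<partial>lborel)"
  proof (rule nn_integral_mono)
    fix x :: real
    have "?k * \<bar>x\<bar> powr (- 1 - \<alpha>) \<le> ?k * m powr (- 1 - \<alpha>)" if "x \<in> {l<..<u}"
      using z[OF that] \<alpha> k m by (intro mult_left_mono powr_mono2') auto
    then show "?f x * indicator {l<..<u} x \<le> ennreal (?k * m powr (- 1 - \<alpha>)) * indicator {l<..<u} x"
      by (auto simp: indicator_def intro: ennreal_leI)
  qed
  also have "\<dots> = ennreal (?k * m powr (- 1 - \<alpha>)) * emeasure lborel {l<..<u}"
    by (rule nn_integral_cmult_indicator) simp
  also have "\<dots> < \<infinity>" using lu by (simp add: ennreal_mult_less_top)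
  finally show "emeasure (stable_measure \<alpha>) {l<..<u} < \<infinity>" unfolding eq .
qed

lemma levy_jumps_stable:
  assumes "levy_law P (stable_measure \<alpha>)" "0 < \<alpha>" "\<alpha> < 2"
  shows "levy_jumps P (stable_measure \<alpha>)"
proof (intro levy_jumps.intro levy.intro levy_jumps_axioms.intro)
  show "sigma_finite_measure (stable_measure \<alpha>)"
    unfolding stable_measure_def by (subst sigma_finite_measure.sigma_finite_iff_density_finite[OF sigma_finite_lborel]) auto
qed (use assms stable_measure_charge in auto)

text \<open>The intervals in \<open>charge\<close> lie where the truncating indicator is 1, so their
  mass is that of the stable measure.\<close>

lemma levy_jumps_truncated:
  assumes "levy_law P (truncated_stable_measure \<alpha>)" "0 < \<alpha>" "\<alpha> < 2"
  shows "levy_jumps P (truncated_stable_measure \<alpha>)"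
proof (intro levy_jumps.intro levy.intro levy_jumps_axioms.intro)
  show "sigma_finite_measure (truncated_stable_measure \<alpha>)"
    unfolding truncated_stable_measure_def stable_measure_def
    by (subst density_density_eq) (auto simp: sigma_finite_measure.sigma_finite_iff_density_finite[OF sigma_finite_lborel] indicator_def)
  fix l u :: real assume lu: "l < u" "0 < l \<and> u < 1 \<or> - 1 < l \<and> u < 0"
  have "emeasure (truncated_stable_measure \<alpha>) {l<..<u}
      = (\<integral>\<^sup>+z. indicator {z. \<bar>z\<bar> < 1} z * indicator {l<..<u} z \<partial>stable_measure \<alpha>)"
  proof -
    have "{z :: real. \<bar>z\<bar> < 1} \<in> sets borel" by measurable
    then show ?thesis
      unfolding truncated_stable_measure_def by (intro emeasure_density borel_measurable_indicator) simp_all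
  qed
  also have "\<dots> = (\<integral>\<^sup>+z. indicator {l<..<u} z \<partial>stable_measure \<alpha>)"
    using lu by (intro nn_integral_cong) (auto simp: indicator_def)
  also have "\<dots> = emeasure (stable_measure \<alpha>) {l<..<u}" by simp
  finally show "0 < emeasure (truncated_stable_measure \<alpha>) {l<..<u} \<and>
      emeasure (truncated_stable_measure \<alpha>) {l<..<u} < \<infinity>"
    using stable_measure_charge[OF assms(2,3) lu] by simp
qed (use assms in \<open>auto simp: truncated_stable_measure_def\<close>)

theorem theorem3p3:
  fixes \<alpha> \<beta> \<sigma> :: real
    and P :: "(real \<Rightarrow> real) measure"
    and \<phi> :: "real \<Rightarrow> (real \<Rightarrow> real) \<Rightarrow> real \<Rightarrow> real"
    and a :: "(real \<Rightarrow> real) \<Rightarrow> real"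
  assumes "1 < \<alpha>" and "\<alpha> < 2" and "\<sigma> \<noteq> 0"
    and "stable_law \<alpha> P \<or> truncated_stable_law \<alpha> P"
    and "sde_rds \<beta> \<sigma> \<phi>"
    and "attracting_random_equilibrium P \<phi> a"
  shows "(\<beta> < 0 \<longrightarrow>
            (AE \<omega> in P. \<forall>x. \<forall>t\<ge>0.
               \<bar>\<phi> t \<omega> x - \<phi> t \<omega> (a \<omega>)\<bar> \<le> exp (\<beta> * t) * \<bar>x - a \<omega>\<bar>)) \<and>
         (\<beta> > 0 \<longrightarrow>
            \<not> (\<exists>\<delta>>0.
               ((\<lambda>t. SUP x\<in>{- \<delta><..<\<delta>}.
                    esssup P (\<lambda>\<omega>. ennreal \<bar>\<phi> t \<omega> (a \<omega> + x) - a (shift t \<omega>)\<bar>))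
                 \<longlongrightarrow> 0) at_top))"
proof -
  obtain \<nu> where "levy_jumps P \<nu>"
    using assms levy_jumps_stable[of P \<alpha>] levy_jumps_truncated[of P \<alpha>]
    unfolding stable_law_def truncated_stable_law_def by auto
  then interpret levy_jumps P \<nu> .
  have "AE \<omega> in P. \<forall>x. \<forall>t\<ge>0. \<bar>\<phi> t \<omega> x - \<phi> t \<omega> (a \<omega>)\<bar> \<le> exp (\<beta> * t) * \<bar>x - a \<omega>\<bar>"
    using sde_rds_contraction[OF assms(5)] by (intro AE_I2) simp
  moreover have "\<not> (\<exists>\<delta>>0. ((\<lambda>t. SUP x\<in>{- \<delta><..<\<delta>}.
      esssup P (\<lambda>\<omega>. ennreal \<bar>\<phi> t \<omega> (a \<omega> + x) - a (shift t \<omega>)\<bar>)) \<longlongrightarrow> 0) at_top)" if "\<beta> > 0"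
    using not_locally_uniformly_attractive[OF assms(5) that assms(3,6)] by blast
  ultimately show ?thesis by blast
qed

end
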